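(* Let $\{S_t\}_{t\ge0}$ be a weighted translation semigroup on $L^2(\mathbb R_+)$ with symbol $\varphi\in C^\infty$. If $\{S_t\}$ is completely hyperexpansive, then its Cauchy dual $\{S_t'\}$ is a subnormal contraction (that is, every $S_t'$, $t\in\mathbb R_+$, is a subnormal operator and a contraction).
   Context: $\mathbb R_+=[0,\infty)$, and $L^2(\mathbb R_+)$ is the Hilbert space of complex-valued square-integrable Lebesgue measurable functions on $\mathbb R_+$. A symbol is a continuous, strictly positive function $\varphi:\mathbb R_+\to(0,\infty)$ such that for every $t\in\mathbb R_+$ the weight function $\varphi_t(x)=\sqrt{\varphi(x)/\varphi(x-t)}$ for $x\ge t$, $\varphi_t(x)=0$ for $x<t$, is essentially bounded. The weighted translation semigroup with symbol $\varphi$ is the family $\{S_t:t\in\mathbb R_+\}$ of bounded operators on $L^2(\mathbb R_+)$ given by $S_tf(x)=\varphi_t(x)f(x-t)$ for $x\ge t$ and $S_tf(x)=0$ for $x<t$. Derivatives at $0$ are one-sided. A bounded operator $T$ is completely hyperexpansive if $\sum_{k=0}^n(-1)^k\binom nk T^{*k}T^k\le0$ for all integers $n\ge1$; the semigroup $\{S_t\}$ is completely hyperexpansive if every $S_t$ is. $T$ on $H$ is subnormal if there are a Hilbert space $K\supseteq H$ and a normal operator $N$ on $K$ with $NH\subseteq H$ and $N|_H=T$; it is a contraction if $I-T^*T\ge0$. The Cauchy dual of a left invertible operator $T$ is $T'=T(T^*T)^{-1}$. If every $S_t$ is left invertible (which holds automatically when $\{S_t\}$ is completely hyperexpansive, since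 then $S_t^*S_t\ge I$), the Cauchy dual of the semigroup $\{S_t\}$ is the family $\{S_t'\}$ with $S_t'=S_t(S_t^*S_t)^{-1}$; explicitly $S_t'f(x)=\frac{1}{\varphi_t(x)}f(x-t)$ for $x\ge t$ and $0$ for $x<t$. *)

theory Defs
  imports "HOL-Analysis.Analysis" "HOL-Algebra.Module"
begin

section \<open>Complex Hilbert spaces with explicit carrier\<close>

text \<open>
  Subnormality quantifies existentially over Hilbert spaces, so Hilbert spaces are records rather
  than types. The vector space structure is that of a module over the ring record of the complex
  numbers; as always for module records, the fields for multiplication and unit are meaningless.
  The inner product is linear in its first argument.
\<close>

definition complex_ring :: "complex ring" where
  "complex_ring = \<lparr> carrier = UNIV, mult = (*), one = 1, zero = 0, add = (+) \<rparr>"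

record 'a cinner_space = "(complex, 'a) module" +
  cinner :: "'a \<Rightarrow> 'a \<Rightarrow> complex"

definition hnorm :: "'a cinner_space \<Rightarrow> 'a \<Rightarrow> real" where
  "hnorm H x = sqrt (Re (cinner H x x))"

text \<open>The value off the carrier only serves to meet the axioms of \<^locale>\<open>Metric_space\<close>.\<close>

definition hdist :: "'a cinner_space \<Rightarrow> 'a \<Rightarrow> 'a \<Rightarrow> real" where
  "hdist H x y = (if x \<in> carrier H \<and> y \<in> carrier H then hnorm H (x \<ominus>\<^bsub>H\<^esub> y) else 0)"

locale complex_inner_space =
  module complex_ring H for H :: "'a cinner_space" (structure) +
  assumes cinner_add_left:
      "\<lbrakk>x \<in> carrier H; y \<in> carrier H; z \<in> carrier H\<rbrakk>
        \<Longrightarrow> cinner H (x \<oplus> y) z = cinner H x z + cinner H y z"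
    and cinner_smult_left:
      "\<lbrakk>x \<in> carrier H; y \<in> carrier H\<rbrakk> \<Longrightarrow> cinner H (c \<odot> x) y = c * cinner H x y"
    and cinner_commute:
      "\<lbrakk>x \<in> carrier H; y \<in> carrier H\<rbrakk> \<Longrightarrow> cinner H x y = cnj (cinner H y x)"
    and cinner_self_nonneg: "x \<in> carrier H \<Longrightarrow> cinner H x x \<in> \<real>\<^sub>\<ge>\<^sub>0"
    and cinner_self_eq_zeroD: "\<lbrakk>x \<in> carrier H; cinner H x x = 0\<rbrakk> \<Longrightarrow> x = \<zero>"

locale complex_hilbert_space = complex_inner_space +
  assumes complete: "Metric_space.mcomplete (carrier H) (hdist H)"

section \<open>Operators\<close>

text \<open>Operators are functions whose values off the carrier are irrelevant.\<close>

definition linear_map :: "'a cinner_space \<Rightarrow> 'b cinner_space \<Rightarrow> ('a \<Rightarrow> 'b) \<Rightarrow> bool" where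
  "linear_map H K T \<longleftrightarrow>
     T \<in> carrier H \<rightarrow> carrier K \<and>
     (\<forall>x\<in>carrier H. \<forall>y\<in>carrier H. T (x \<oplus>\<^bsub>H\<^esub> y) = T x \<oplus>\<^bsub>K\<^esub> T y) \<and>
     (\<forall>c. \<forall>x\<in>carrier H. T (c \<odot>\<^bsub>H\<^esub> x) = c \<odot>\<^bsub>K\<^esub> T x)"

definition bounded_operator :: "'a cinner_space \<Rightarrow> ('a \<Rightarrow> 'a) \<Rightarrow> bool" where
  "bounded_operator H T \<longleftrightarrow>
     linear_map H H T \<and> (\<exists>C. \<forall>x\<in>carrier H. hnorm H (T x) \<le> C * hnorm H x)"

definition isometric_embedding :: "'a cinner_space \<Rightarrow> 'b cinner_space \<Rightarrow> ('a \<Rightarrow> 'b) \<Rightarrow> bool" where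
  "isometric_embedding H K V \<longleftrightarrow>
     linear_map H K V \<and>
     (\<forall>x\<in>carrier H. \<forall>y\<in>carrier H. cinner K (V x) (V y) = cinner H x y)"

text \<open>
  For a bounded operator on a Hilbert space the described vector exists uniquely by the Riesz
  representation theorem.
\<close>

definition adj :: "'a cinner_space \<Rightarrow> ('a \<Rightarrow> 'a) \<Rightarrow> 'a \<Rightarrow> 'a" where
  "adj H T y = (THE z. z \<in> carrier H \<and> (\<forall>x\<in>carrier H. cinner H (T x) y = cinner H x z))"

definition op_le :: "'a cinner_space \<Rightarrow> ('a \<Rightarrow> 'a) \<Rightarrow> ('a \<Rightarrow> 'a) \<Rightarrow> bool" where
  "op_le H A B \<longleftrightarrow> (\<forall>x\<in>carrier H. cinner H (B x \<ominus>\<^bsub>H\<^esub> A x) x \<in> \<real>\<^sub>\<ge>\<^sub>0)"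

definition contraction :: "'a cinner_space \<Rightarrow> ('a \<Rightarrow> 'a) \<Rightarrow> bool" where
  "contraction H T \<longleftrightarrow>
     bounded_operator H T \<and> op_le H (\<lambda>x. \<zero>\<^bsub>H\<^esub>) (\<lambda>x. x \<ominus>\<^bsub>H\<^esub> adj H T (T x))"

definition completely_hyperexpansive :: "'a cinner_space \<Rightarrow> ('a \<Rightarrow> 'a) \<Rightarrow> bool" where
  "completely_hyperexpansive H T \<longleftrightarrow>
     bounded_operator H T \<and>
     (\<forall>n\<ge>1. op_le H
        (\<lambda>x. \<Oplus>\<^bsub>H\<^esub>k\<in>{..n}. ((-1) ^ k * of_nat (n choose k)) \<odot>\<^bsub>H\<^esub> (adj H T ^^ k) ((T ^^ k) x))
        (\<lambda>x. \<zero>\<^bsub>H\<^esub>))"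

definition normal_operator :: "'a cinner_space \<Rightarrow> ('a \<Rightarrow> 'a) \<Rightarrow> bool" where
  "normal_operator H N \<longleftrightarrow>
     bounded_operator H N \<and> (\<forall>x\<in>carrier H. N (adj H N x) = adj H N (N x))"

text \<open>
  The inclusion of \<open>H\<close> in the larger space \<open>K\<close> is an isometric embedding \<open>V\<close>; that \<open>N\<close> leaves \<open>H\<close>
  invariant and restricts to \<open>T\<close> then reads \<open>N \<circ> V = V \<circ> T\<close>.

  Letting \<open>K\<close> range over Hilbert spaces in the same type \<open>'a\<close> as \<open>H\<close> loses nothing. The closed span of
  all \<open>(adj K N ^^ k) (V x)\<close> reduces \<open>N\<close>, so one may take \<open>K\<close> to be this span. If \<open>H\<close> is
  infinite-dimensional of density \<open>d\<close>, then \<open>K\<close> also has density \<open>d\<close>, and both have \<open>d ^ \<aleph>\<^sub>0\<close> elements,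
  so a copy of \<open>K\<close> fits in \<open>'a\<close>. If \<open>H\<close> is finite-dimensional, a subnormal operator on \<open>H\<close> is normal and
  \<open>K = H\<close> will do.
\<close>

definition subnormal :: "'a cinner_space \<Rightarrow> ('a \<Rightarrow> 'a) \<Rightarrow> bool" where
  "subnormal H T \<longleftrightarrow>
     bounded_operator H T \<and>
     (\<exists>(K :: 'a cinner_space) V N.
        complex_hilbert_space K \<and> isometric_embedding H K V \<and> normal_operator K N \<and>
        (\<forall>x\<in>carrier H. N (V x) = V (T x)))"

text \<open>Meaningful only for left invertible \<open>T\<close>, where \<open>adj H T \<circ> T\<close> is a bijection of the carrier.\<close>

definition cauchy_dual :: "'a cinner_space \<Rightarrow> ('a \<Rightarrow> 'a) \<Rightarrow> 'a \<Rightarrow> 'a" where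
  "cauchy_dual H T = T \<circ> inv_into (carrier H) (adj H T \<circ> T)"

section \<open>The space of square-integrable functions\<close>

text \<open>Vectors are classes of almost everywhere equal functions.\<close>

definition L2_fun :: "'m measure \<Rightarrow> ('m \<Rightarrow> complex) set" where
  "L2_fun M = {f \<in> borel_measurable M. integrable M (\<lambda>x. (cmod (f x))\<^sup>2)}"

definition L2_class :: "'m measure \<Rightarrow> ('m \<Rightarrow> complex) \<Rightarrow> ('m \<Rightarrow> complex) set" where
  "L2_class M f = {g \<in> L2_fun M. AE x in M. f x = g x}"

definition L2_rep :: "('m \<Rightarrow> complex) set \<Rightarrow> 'm \<Rightarrow> complex" where
  "L2_rep F = (SOME f. f \<in> F)"

definition L2 :: "'m measure \<Rightarrow> ('m \<Rightarrow> complex) set cinner_space" where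
  "L2 M = \<lparr> carrier = L2_class M ` L2_fun M, mult = undefined, one = undefined,
     zero = L2_class M (\<lambda>x. 0),
     add = (\<lambda>F G. L2_class M (\<lambda>x. L2_rep F x + L2_rep G x)),
     smult = (\<lambda>c F. L2_class M (\<lambda>x. c * L2_rep F x)),
     cinner = (\<lambda>F G. \<integral>x. L2_rep F x * cnj (L2_rep G x) \<partial>M) \<rparr>"

section \<open>Weighted translation semigroups\<close>

abbreviation half_line :: "real measure" where
  "half_line \<equiv> lebesgue_on {0..}"

definition weight :: "(real \<Rightarrow> real) \<Rightarrow> real \<Rightarrow> real \<Rightarrow> real" where
  "weight \<phi> t x = (if t \<le> x then sqrt (\<phi> x / \<phi> (x - t)) else 0)"

text \<open>Functions on the half line are represented by total functions; values on the negative
  numbers play no role.\<close>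

definition symbol :: "(real \<Rightarrow> real) \<Rightarrow> bool" where
  "symbol \<phi> \<longleftrightarrow>
     continuous_on {0..} \<phi> \<and> (\<forall>x\<ge>0. 0 < \<phi> x) \<and>
     (\<forall>t\<ge>0. \<exists>C. AE x in half_line. \<bar>weight \<phi> t x\<bar> \<le> C)"

text \<open>\<open>D n\<close> is the \<open>n\<close>-th derivative, one-sided at the endpoint.\<close>

definition smooth_half_line :: "(real \<Rightarrow> real) \<Rightarrow> bool" where
  "smooth_half_line \<phi> \<longleftrightarrow>
     (\<exists>D :: nat \<Rightarrow> real \<Rightarrow> real. (\<forall>x\<ge>0. D 0 x = \<phi> x) \<and>
        (\<forall>n. \<forall>x\<ge>0. (D n has_real_derivative D (Suc n) x) (at x within {0..})))"

definition weighted_translation ::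
    "(real \<Rightarrow> real) \<Rightarrow> real \<Rightarrow> (real \<Rightarrow> complex) set \<Rightarrow> (real \<Rightarrow> complex) set" where
  "weighted_translation \<phi> t F =
     L2_class half_line
       (\<lambda>x. if t \<le> x then complex_of_real (weight \<phi> t x) * L2_rep F (x - t) else 0)"

end

theory Submission
  imports Defs "HOL-Probability.Helly_Selection"
begin

text \<open>
  Let \<open>\<psi> = 1 / \<phi>\<close>. The operator \<open>T\<^sup>*\<^sup>kT\<^sup>k\<close>, for \<open>T = S\<^sub>t\<close>, is multiplication by \<open>\<phi> (x + k t) / \<phi> x\<close>. Testing
  complete hyperexpansivity on \<open>\<surd>\<phi>\<close> cut off to small intervals therefore shows that all differences
  \<open>\<nabla>\<^sup>n \<phi>\<close> with \<open>n \<ge> 1\<close> and \<open>\<nabla> f x = f x - f (x + t)\<close> are nonpositive (\<open>ndiff_nonpos\<close>). In particular \<open>\<phi>\<close>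
  increases, \<open>T\<^sup>*T\<close> is invertible, and the Cauchy dual is the weighted translation with symbol \<open>\<psi>\<close>
  (\<open>cauchy_dual_eq\<close>). It is a contraction because \<open>\<psi>\<close> decreases.

  By the Leibniz rule for differences, applied to the constant \<open>\<phi> \<psi> = 1\<close>, all differences of \<open>\<psi>\<close> are
  nonnegative (\<open>ndiff_inverse_nonneg\<close>). So \<open>\<psi>\<close> is completely monotone, and Bernstein's theorem gives a
  probability measure \<open>M\<close> with \<open>\<psi> x / \<psi> 0 = \<integral> u\<^sup>x dM(u)\<close> for \<open>x > 0\<close>, where \<open>u\<close> is truncated to \<open>[0, 1]\<close>
  (\<open>bernstein\<close>).

  For the symbol \<open>u\<^sup>x\<close> with a single \<open>u\<close> the weighted translation is the constant \<open>u\<^sup>t\<^sup>/\<^sup>2\<close> times an isometric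
  shift, and shifts of the half line extend to translations of the line. Mixing over \<open>u\<close> with the measure
  \<open>M\<close> yields the normal operator \<open>N f (x, u) = u\<^sup>t\<^sup>/\<^sup>2 f (x - t, u)\<close> on \<open>L\<^sup>2\<close> of \<open>lebesgue \<Otimes> M\<close>. The map
  \<open>V f (x, u) = \<surd>(u\<^sup>x \<psi> 0 / \<psi> x) f x\<close> for \<open>x \<ge> 0\<close>, extended by zero, is isometric by the formula for \<open>\<psi>\<close>
  and intertwines the weighted translation with \<open>N\<close> (\<open>subnormal_of_moments\<close>).
\<close>

section \<open>Inner product spaces\<close>

lemma complex_ring_simps [simp]:
  "carrier complex_ring = UNIV" "mult complex_ring = (*)" "one complex_ring = 1"
  "zero complex_ring = 0" "add complex_ring = (+)"
  by (simp_all add: complex_ring_def)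

lemma cring_complex_ring: "cring complex_ring"
proof (intro cringI abelian_groupI comm_monoidI)
  fix x :: complex
  show "\<exists>y\<in>carrier complex_ring. y \<oplus>\<^bsub>complex_ring\<^esub> x = \<zero>\<^bsub>complex_ring\<^esub>"
    by (intro bexI[of _ "- x"]) auto
qed (auto simp: algebra_simps)

context complex_inner_space
begin

lemma smult_zero: "x \<in> carrier H \<Longrightarrow> 0 \<odot> x = \<zero>"
  using smult_l_null by simp

lemma cinner_zero_left: "y \<in> carrier H \<Longrightarrow> cinner H \<zero> y = 0"
  using cinner_smult_left[of y y 0] by (simp add: smult_zero)

lemma cinner_uminus_left:
  assumes "x \<in> carrier H" "y \<in> carrier H" shows "cinner H (\<ominus> x) y = - cinner H x y"
proof -
  have "cinner H (\<ominus> x) y + cinner H x y = cinner H (\<ominus> x \<oplus> x) y"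
    using assms by (simp add: cinner_add_left)
  also have "\<dots> = 0" using assms by (simp add: M.l_neg cinner_zero_left)
  finally show ?thesis by (simp add: eq_neg_iff_add_eq_0)
qed

lemma cinner_minus_left:
  assumes "x \<in> carrier H" "y \<in> carrier H" "z \<in> carrier H"
  shows "cinner H (x \<ominus> y) z = cinner H x z - cinner H y z"
  using assms by (simp add: a_minus_def cinner_add_left cinner_uminus_left)

lemma cinner_minus_right:
  assumes "x \<in> carrier H" "y \<in> carrier H" "z \<in> carrier H"
  shows "cinner H x (y \<ominus> z) = cinner H x y - cinner H x z"
  using assms cinner_commute[of x] by (simp add: cinner_minus_left)

lemma cinner_finsum_left:
  assumes "finite A" "\<And>k. k \<in> A \<Longrightarrow> f k \<in> carrier H" "y \<in> carrier H"
  shows "cinner H (\<Oplus>k\<in>A. f k) y = (\<Sum>k\<in>A. cinner H (f k) y)"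
  using assms
proof (induction A)
  case empty
  then show ?case by (simp add: cinner_zero_left)
next
  case (insert a A)
  then have "f \<in> A \<rightarrow> carrier H" by auto
  with insert show ?case by (simp add: M.finsum_insert cinner_add_left)
qed

lemma hnorm_sq: "x \<in> carrier H \<Longrightarrow> complex_of_real ((hnorm H x)\<^sup>2) = cinner H x x"
  using cinner_self_nonneg[of x]
  by (auto simp: hnorm_def nonneg_Reals_def complex_is_Real_iff complex_eq_iff elim!: nonneg_Reals_cases)

text \<open>The definite description in \<^const>\<open>adj\<close> is resolved by any candidate: definiteness of the
  inner product makes the adjoint vector unique.\<close>

lemma adj_eqI:
  assumes "y \<in> carrier H" "z \<in> carrier H"
    and "\<And>x. x \<in> carrier H \<Longrightarrow> cinner H (T x) y = cinner H x z"
  shows "adj H T y = z"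
  unfolding adj_def
proof (rule the_equality)
  fix z' assume z': "z' \<in> carrier H \<and> (\<forall>x\<in>carrier H. cinner H (T x) y = cinner H x z')"
  define d where "d = z' \<ominus> z"
  have d: "d \<in> carrier H" using z' assms by (simp add: d_def)
  have "cinner H d d = cinner H d z' - cinner H d z"
    using cinner_minus_right[of d z' z] d z' assms unfolding d_def by blast
  also have "\<dots> = 0" using z' assms(3) d by (metis diff_self)
  finally have "d = \<zero>" using cinner_self_eq_zeroD d by blast
  then have "z' \<oplus> \<ominus> z = \<zero>" by (simp add: d_def a_minus_def)
  then have "z' = \<ominus> (\<ominus> z)" using z' assms(2) M.minus_equality[of z' "\<ominus> z"] by simp
  then show "z' = z" using assms(2) by simp
qed (use assms in auto)

text \<open>Evaluating the defining operator inequality at \<open>x\<close> turns it into an inequality between the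
  norms of the iterates.\<close>

lemma completely_hyperexpansive_norms:
  assumes che: "completely_hyperexpansive H T" and B: "B \<in> carrier H \<rightarrow> carrier H"
    and adj: "\<And>x y. x \<in> carrier H \<Longrightarrow> y \<in> carrier H \<Longrightarrow> cinner H (T x) y = cinner H x (B y)"
    and x: "x \<in> carrier H" and n: "1 \<le> n"
  shows "(\<Sum>k\<le>n. (- 1) ^ k * real (n choose k) * (hnorm H ((T ^^ k) x))\<^sup>2) \<le> 0"
proof -
  have T: "T \<in> carrier H \<rightarrow> carrier H"
    using che by (auto simp: completely_hyperexpansive_def bounded_operator_def linear_map_def)
  have adjB: "adj H T y = B y" if "y \<in> carrier H" for y
    using adj_eqI[of y "B y" T] that B adj by auto
  have Tk: "(T ^^ k) y \<in> carrier H" if "y \<in> carrier H" for k y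
    using that T by (induction k) auto
  have Ak: "(adj H T ^^ k) y \<in> carrier H" if "y \<in> carrier H" for k y
    using that B by (induction k) (auto simp: adjB)
  have pull: "cinner H ((adj H T ^^ k) y) z = cinner H y ((T ^^ k) z)"
    if "y \<in> carrier H" "z \<in> carrier H" for k y z
    using that
  proof (induction k arbitrary: z)
    case (Suc k)
    have "cinner H (adj H T ((adj H T ^^ k) y)) z = cinner H ((adj H T ^^ k) y) (T z)"
      using adj[of z "(adj H T ^^ k) y"] Suc.prems Ak[of y k] adjB[of "(adj H T ^^ k) y"] B T
        cinner_commute[of "B ((adj H T ^^ k) y)" z] cinner_commute[of "T z" "(adj H T ^^ k) y"]
      by (metis PiE complex_cnj_cnj)
    also have "\<dots> = cinner H y ((T ^^ k) (T z))"
      using Suc T by auto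
    finally show ?case by (simp add: funpow_swap1)
  qed simp
  define c where "c k = ((- 1) ^ k * of_nat (n choose k) :: complex)" for k
  define s where "s = (\<Oplus>k\<in>{..n}. c k \<odot> (adj H T ^^ k) ((T ^^ k) x))"
  have terms: "c k \<odot> (adj H T ^^ k) ((T ^^ k) x) \<in> carrier H" for k
    using Ak Tk x by auto
  have s: "s \<in> carrier H" unfolding s_def using terms by (intro M.finsum_closed) auto
  have "cinner H (\<zero> \<ominus> s) x \<in> \<real>\<^sub>\<ge>\<^sub>0"
    using che n x unfolding completely_hyperexpansive_def op_le_def s_def c_def by blast
  moreover have "cinner H (\<zero> \<ominus> s) x = - cinner H s x"
    using s x by (simp add: cinner_minus_left cinner_zero_left)
  moreover have "cinner H s x = (\<Sum>k\<le>n. c k * complex_of_real ((hnorm H ((T ^^ k) x))\<^sup>2))"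
  proof -
    have "cinner H s x = (\<Sum>k\<le>n. cinner H (c k \<odot> (adj H T ^^ k) ((T ^^ k) x)) x)"
      unfolding s_def using terms x by (intro cinner_finsum_left) auto
    also have "\<dots> = (\<Sum>k\<le>n. c k * complex_of_real ((hnorm H ((T ^^ k) x))\<^sup>2))"
      using Ak Tk x by (intro sum.cong refl) (simp add: cinner_smult_left pull hnorm_sq del: of_real_power)
    finally show ?thesis .
  qed
  moreover have "\<dots> = complex_of_real (\<Sum>k\<le>n. (- 1) ^ k * real (n choose k) * (hnorm H ((T ^^ k) x))\<^sup>2)"
    by (simp add: c_def)
  ultimately have "complex_of_real (- (\<Sum>k\<le>n. (- 1) ^ k * real (n choose k) * (hnorm H ((T ^^ k) x))\<^sup>2)) \<in> \<real>\<^sub>\<ge>\<^sub>0"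
    by (simp only: of_real_minus)
  then show ?thesis by (simp only: nonneg_Reals_of_real_iff neg_0_le_iff_le)
qed

end

section \<open>The Hilbert space of square-integrable functions\<close>

lemma L2_fun_measurable: "f \<in> L2_fun M \<Longrightarrow> f \<in> borel_measurable M"
  and L2_fun_integrable: "f \<in> L2_fun M \<Longrightarrow> integrable M (\<lambda>x. (cmod (f x))\<^sup>2)"
  by (auto simp: L2_fun_def)

text \<open>Weighting the cross term by a free parameter \<open>r\<close> gives the triangle inequality of \<open>L\<^sup>2\<close> without
  the Cauchy--Schwarz inequality: integrate, then choose for \<open>r\<close> the quotient of the norms of \<open>b\<close> and \<open>a\<close>.\<close>

lemma cmod_add_sq_le: "(cmod (a + b))\<^sup>2 \<le> (1 + r) * (cmod a)\<^sup>2 + (1 + 1 / r) * (cmod b)\<^sup>2" if "r > 0"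
proof -
  have "(cmod (a + b))\<^sup>2 \<le> (cmod a + cmod b)\<^sup>2"
    by (intro power_mono norm_triangle_ineq) auto
  also have "\<dots> + (sqrt r * cmod a - cmod b / sqrt r)\<^sup>2 = (1 + r) * (cmod a)\<^sup>2 + (1 + 1 / r) * (cmod b)\<^sup>2"
    using that by (simp add: power2_eq_square algebra_simps add_divide_distrib)
  then have "(cmod a + cmod b)\<^sup>2 \<le> (1 + r) * (cmod a)\<^sup>2 + (1 + 1 / r) * (cmod b)\<^sup>2"
    by (smt (verit) zero_le_power2)
  finally show ?thesis .
qed

lemma L2_fun_add:
  assumes "f \<in> L2_fun M" "g \<in> L2_fun M" shows "(\<lambda>x. f x + g x) \<in> L2_fun M"
proof -
  have [measurable]: "f \<in> borel_measurable M" "g \<in> borel_measurable M"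
    using assms by (auto intro: L2_fun_measurable)
  have "integrable M (\<lambda>x. 2 * (cmod (f x))\<^sup>2 + 2 * (cmod (g x))\<^sup>2)"
    using assms by (intro Bochner_Integration.integrable_add integrable_mult_right L2_fun_integrable)
  then have "integrable M (\<lambda>x. (cmod (f x + g x))\<^sup>2)"
    by (rule Bochner_Integration.integrable_bound) (auto intro!: AE_I2 order_trans[OF cmod_add_sq_le[of 1]])
  then show ?thesis by (simp add: L2_fun_def)
qed

lemma L2_fun_cmult: "f \<in> L2_fun M \<Longrightarrow> (\<lambda>x. c * f x) \<in> L2_fun M"
  by (auto simp: L2_fun_def norm_mult power_mult_distrib)

lemma L2_fun_zero: "(\<lambda>x. 0) \<in> L2_fun M"
  by (auto simp: L2_fun_def)

lemma L2_fun_diff: "f \<in> L2_fun M \<Longrightarrow> g \<in> L2_fun M \<Longrightarrow> (\<lambda>x. f x - g x) \<in> L2_fun M"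
  using L2_fun_add[of f M "\<lambda>x. - 1 * g x"] L2_fun_cmult[of g M "- 1"] by simp

lemma L2_fun_AE_eq:
  assumes "f \<in> L2_fun M" "g \<in> borel_measurable M" "AE x in M. f x = g x"
  shows "g \<in> L2_fun M"
proof -
  have [measurable]: "f \<in> borel_measurable M" "g \<in> borel_measurable M"
    using assms by (auto intro: L2_fun_measurable)
  have "integrable M (\<lambda>x. (cmod (g x))\<^sup>2) = integrable M (\<lambda>x. (cmod (f x))\<^sup>2)"
    using assms(3) by (intro integrable_cong_AE) auto
  then show ?thesis using assms by (auto simp: L2_fun_def)
qed

lemma L2_fun_iff_nn_integral:
  "f \<in> L2_fun M \<longleftrightarrow> f \<in> borel_measurable M \<and> (\<integral>\<^sup>+x. ennreal ((cmod (f x))\<^sup>2) \<partial>M) < \<infinity>"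
  unfolding L2_fun_def using integrable_iff_bounded[of M "\<lambda>x. (cmod (f x))\<^sup>2"] by auto

lemma nn_integral_L2_fun:
  "f \<in> L2_fun M \<Longrightarrow> (\<integral>\<^sup>+x. ennreal ((cmod (f x))\<^sup>2) \<partial>M) = ennreal (\<integral>x. (cmod (f x))\<^sup>2 \<partial>M)"
  by (intro nn_integral_eq_integral L2_fun_integrable) auto

lemma integrable_L2_cnj:
  assumes "f \<in> L2_fun M" "g \<in> L2_fun M" shows "integrable M (\<lambda>x. f x * cnj (g x))"
proof (rule Bochner_Integration.integrable_bound)
  show "integrable M (\<lambda>x. (cmod (f x))\<^sup>2 + (cmod (g x))\<^sup>2)"
    using assms by (auto intro: L2_fun_integrable)
  have "a * b \<le> a\<^sup>2 + b\<^sup>2" if "a \<ge> 0" "b \<ge> 0" for a b :: real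
    using that sum_squares_bound[of a b] mult_nonneg_nonneg[OF that] by linarith
  then show "AE x in M. norm (f x * cnj (g x)) \<le> norm ((cmod (f x))\<^sup>2 + (cmod (g x))\<^sup>2)"
    by (auto simp: norm_mult)
  show "(\<lambda>x. f x * cnj (g x)) \<in> borel_measurable M"
    using assms[THEN L2_fun_measurable] by (intro borel_measurable_times) (auto intro: measurable_compose[OF _ borel_measurable_continuous_onI[OF continuous_on_cnj[OF continuous_on_id]]])
qed

lemma L2_class_eq_iff:
  assumes "f \<in> L2_fun M" "g \<in> L2_fun M"
  shows "L2_class M f = L2_class M g \<longleftrightarrow> (AE x in M. f x = g x)"
proof
  assume "L2_class M f = L2_class M g"
  moreover have "g \<in> L2_class M g" using assms by (simp add: L2_class_def)
  ultimately have "g \<in> L2_class M f" by simp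
  then show "AE x in M. f x = g x" by (simp add: L2_class_def)
next
  assume *: "AE x in M. f x = g x"
  have "(AE x in M. f x = h x) \<longleftrightarrow> (AE x in M. g x = h x)" for h
    using * by (auto elim: AE_mp)
  then show "L2_class M f = L2_class M g" by (simp add: L2_class_def)
qed

lemma L2_class_eqI:
  assumes "f \<in> L2_fun M" "g \<in> L2_fun M" "AE x in M. f x = g x"
  shows "L2_class M f = L2_class M g"
  using assms L2_class_eq_iff by blast

lemma L2_rep_class:
  assumes "f \<in> L2_fun M"
  shows "L2_rep (L2_class M f) \<in> L2_fun M" "AE x in M. L2_rep (L2_class M f) x = f x"
proof -
  have "f \<in> L2_class M f" using assms by (simp add: L2_class_def)
  then have "L2_rep (L2_class M f) \<in> L2_class M f" unfolding L2_rep_def by (rule someI[of "\<lambda>f'. f' \<in> L2_class M f"])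
  then show "L2_rep (L2_class M f) \<in> L2_fun M" "AE x in M. L2_rep (L2_class M f) x = f x"
    by (auto simp: L2_class_def)
qed

lemma carrier_L2: "carrier (L2 M) = L2_class M ` L2_fun M"
  by (simp add: L2_def)

lemma L2_class_in_carrier [simp]: "f \<in> L2_fun M \<Longrightarrow> L2_class M f \<in> carrier (L2 M)"
  by (simp add: carrier_L2)

lemma L2_carrierE:
  assumes "F \<in> carrier (L2 M)" obtains f where "f \<in> L2_fun M" "F = L2_class M f"
  using assms by (auto simp: carrier_L2)

lemma L2_zero: "\<zero>\<^bsub>L2 M\<^esub> = L2_class M (\<lambda>x. 0)"
  by (simp add: L2_def)

lemma L2_add:
  assumes "f \<in> L2_fun M" "g \<in> L2_fun M"
  shows "L2_class M f \<oplus>\<^bsub>L2 M\<^esub> L2_class M g = L2_class M (\<lambda>x. f x + g x)"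
proof -
  have "AE x in M. L2_rep (L2_class M f) x + L2_rep (L2_class M g) x = f x + g x"
    using L2_rep_class(2)[OF assms(1)] L2_rep_class(2)[OF assms(2)] by eventually_elim simp
  then have "L2_class M (\<lambda>x. L2_rep (L2_class M f) x + L2_rep (L2_class M g) x) = L2_class M (\<lambda>x. f x + g x)"
    using assms by (intro L2_class_eqI L2_fun_add L2_rep_class(1))
  then show ?thesis by (simp add: L2_def)
qed

lemma L2_smult:
  assumes "f \<in> L2_fun M"
  shows "c \<odot>\<^bsub>L2 M\<^esub> L2_class M f = L2_class M (\<lambda>x. c * f x)"
proof -
  have "AE x in M. c * L2_rep (L2_class M f) x = c * f x"
    using L2_rep_class(2)[OF assms(1)] by eventually_elim simp
  then have "L2_class M (\<lambda>x. c * L2_rep (L2_class M f) x) = L2_class M (\<lambda>x. c * f x)"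
    using assms by (intro L2_class_eqI L2_fun_cmult L2_rep_class(1))
  then show ?thesis by (simp add: L2_def)
qed

lemma L2_cinner:
  assumes "f \<in> L2_fun M" "g \<in> L2_fun M"
  shows "cinner (L2 M) (L2_class M f) (L2_class M g) = (\<integral>x. f x * cnj (g x) \<partial>M)"
proof -
  have "AE x in M. L2_rep (L2_class M f) x * cnj (L2_rep (L2_class M g) x) = f x * cnj (g x)"
    using L2_rep_class(2)[OF assms(1)] L2_rep_class(2)[OF assms(2)] by eventually_elim simp
  then have "(\<integral>x. L2_rep (L2_class M f) x * cnj (L2_rep (L2_class M g) x) \<partial>M) = (\<integral>x. f x * cnj (g x) \<partial>M)"
    using assms L2_rep_class(1)
    by (intro integral_cong_AE borel_measurable_integrable integrable_L2_cnj) auto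
  then show ?thesis by (simp add: L2_def)
qed

lemma L2_cinner_self:
  assumes "f \<in> L2_fun M"
  shows "cinner (L2 M) (L2_class M f) (L2_class M f) = complex_of_real (\<integral>x. (cmod (f x))\<^sup>2 \<partial>M)"
  using assms by (simp add: L2_cinner complex_norm_square[symmetric] flip: of_real_power)

lemma L2_hnorm:
  assumes "f \<in> L2_fun M"
  shows "hnorm (L2 M) (L2_class M f) = sqrt (\<integral>x. (cmod (f x))\<^sup>2 \<partial>M)"
  using assms by (simp add: hnorm_def L2_cinner_self)

lemma abelian_group_L2: "abelian_group (L2 M)"
proof (intro abelian_groupI)
  fix x assume "x \<in> carrier (L2 M)"
  then obtain f where f: "f \<in> L2_fun M" "x = L2_class M f" by (elim L2_carrierE)
  show "\<exists>y\<in>carrier (L2 M). y \<oplus>\<^bsub>L2 M\<^esub> x = \<zero>\<^bsub>L2 M\<^esub>"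
    using f L2_fun_cmult[of f M "- 1"]
    by (intro bexI[of _ "L2_class M (\<lambda>x. - 1 * f x)"]) (auto simp: L2_add L2_zero)
qed (auto elim!: L2_carrierE simp: L2_add L2_zero L2_fun_add L2_fun_zero algebra_simps)

lemma module_L2: "module complex_ring (L2 M)"
  unfolding module_def module_axioms_def
  using cring_complex_ring abelian_group_L2[of M]
  by (auto elim!: L2_carrierE simp: L2_add L2_smult L2_fun_add L2_fun_cmult algebra_simps)

interpretation L2: complex_inner_space "L2 M" for M :: "'m measure"
proof (intro complex_inner_space.intro module_L2, unfold_locales)
  fix x y z assume "x \<in> carrier (L2 M)" "y \<in> carrier (L2 M)" "z \<in> carrier (L2 M)"
  then show "cinner (L2 M) (x \<oplus>\<^bsub>L2 M\<^esub> y) z = cinner (L2 M) x z + cinner (L2 M) y z"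
    by (auto elim!: L2_carrierE simp: L2_add L2_cinner L2_fun_add distrib_right integrable_L2_cnj)
next
  fix x y c assume "x \<in> carrier (L2 M)" "y \<in> carrier (L2 M)"
  then show "cinner (L2 M) (c \<odot>\<^bsub>L2 M\<^esub> x) y = c * cinner (L2 M) x y"
    by (auto elim!: L2_carrierE simp: L2_smult L2_cinner L2_fun_cmult mult.assoc integrable_L2_cnj)
next
  fix x y assume "x \<in> carrier (L2 M)" "y \<in> carrier (L2 M)"
  then show "cinner (L2 M) x y = cnj (cinner (L2 M) y x)"
    by (auto elim!: L2_carrierE simp: L2_cinner mult.commute simp flip: Bochner_Integration.integral_cnj)
next
  fix x assume "x \<in> carrier (L2 M)"
  then obtain f where f: "f \<in> L2_fun M" "x = L2_class M f" by (elim L2_carrierE)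
  show "cinner (L2 M) x x \<in> \<real>\<^sub>\<ge>\<^sub>0"
    using f by (simp add: L2_cinner_self)
  assume "cinner (L2 M) x x = 0"
  then have "AE x in M. (cmod (f x))\<^sup>2 = 0"
    using f L2_fun_integrable[of f M] integral_nonneg_eq_0_iff_AE[of M "\<lambda>x. (cmod (f x))\<^sup>2"]
    by (simp add: L2_cinner_self)
  then show "x = \<zero>\<^bsub>L2 M\<^esub>"
    unfolding L2_zero f(2) using f(1) by (intro L2_class_eqI L2_fun_zero) auto
qed

lemma L2_uminus:
  assumes "f \<in> L2_fun M" shows "\<ominus>\<^bsub>L2 M\<^esub> L2_class M f = L2_class M (\<lambda>x. - f x)"
proof (rule L2.M.minus_equality)
  have *: "(\<lambda>x. - f x) \<in> L2_fun M" using L2_fun_cmult[of f M "- 1"] assms by simp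
  show "L2_class M (\<lambda>x. - f x) \<oplus>\<^bsub>L2 M\<^esub> L2_class M f = \<zero>\<^bsub>L2 M\<^esub>"
    using * assms by (simp add: L2_add L2_zero)
  show "L2_class M (\<lambda>x. - f x) \<in> carrier (L2 M)" using * by simp
qed (use assms in simp)

lemma L2_minus:
  assumes "f \<in> L2_fun M" "g \<in> L2_fun M"
  shows "L2_class M f \<ominus>\<^bsub>L2 M\<^esub> L2_class M g = L2_class M (\<lambda>x. f x - g x)"
  using assms L2_fun_cmult[of g M "- 1"] by (simp add: a_minus_def L2_uminus L2_add)

lemma L2_norm_triangle:
  assumes f: "f \<in> L2_fun M" and g: "g \<in> L2_fun M"
  shows "sqrt (\<integral>x. (cmod (f x + g x))\<^sup>2 \<partial>M) \<le> sqrt (\<integral>x. (cmod (f x))\<^sup>2 \<partial>M) + sqrt (\<integral>x. (cmod (g x))\<^sup>2 \<partial>M)"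
    (is "sqrt ?C \<le> sqrt ?A + sqrt ?B")
proof (rule field_le_epsilon)
  fix e :: real assume e: "e > 0"
  \<comment> \<open>The slack \<open>e\<close> makes the bounds \<open>a\<close> and \<open>b\<close> on the two norms positive, so that \<open>b / a\<close> can serve
    as the parameter.\<close>
  define a where "a = sqrt ?A + e / 2"
  define b where "b = sqrt ?B + e / 2"
  have AB: "?A \<ge> 0" "?B \<ge> 0" by simp_all
  have pos: "a > 0" "b > 0" using e AB by (auto simp: a_def b_def intro!: add_nonneg_pos)
  have "sqrt ?A \<le> a" "sqrt ?B \<le> b" using e by (auto simp: a_def b_def)
  then have le: "?A \<le> a\<^sup>2" "?B \<le> b\<^sup>2"
    using real_sqrt_le_iff AB sqrt_le_D by blast+
  define r where "r = b / a"
  have r: "r > 0" using pos by (simp add: r_def)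
  have "?C \<le> (\<integral>x. (1 + r) * (cmod (f x))\<^sup>2 + (1 + 1 / r) * (cmod (g x))\<^sup>2 \<partial>M)"
    using cmod_add_sq_le[OF r] f g by (intro integral_mono) (auto intro!: L2_fun_integrable L2_fun_add)
  also have "\<dots> = (1 + r) * ?A + (1 + 1 / r) * ?B"
    using f g by (simp add: L2_fun_integrable)
  also have "\<dots> \<le> (1 + r) * a\<^sup>2 + (1 + 1 / r) * b\<^sup>2"
    using le r by (intro add_mono mult_left_mono) auto
  also have "\<dots> = (a + b)\<^sup>2"
    using pos by (simp add: r_def field_simps power2_eq_square)
  finally have "sqrt ?C \<le> a + b"
    using pos real_le_lsqrt by force
  then show "sqrt ?C \<le> sqrt ?A + sqrt ?B + e" by (simp add: a_def b_def)
qed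

lemma L2_hdist:
  assumes "f \<in> L2_fun M" "g \<in> L2_fun M"
  shows "hdist (L2 M) (L2_class M f) (L2_class M g) = sqrt (\<integral>x. (cmod (f x - g x))\<^sup>2 \<partial>M)"
  using assms by (simp add: hdist_def L2_minus L2_hnorm L2_fun_diff)

lemma Metric_space_L2: "Metric_space (carrier (L2 M)) (hdist (L2 M))"
proof
  fix x y :: "('a \<Rightarrow> complex) set"
  have nonneg: "hnorm (L2 M) x \<ge> 0" if "x \<in> carrier (L2 M)" for x
    using that by (auto elim!: L2_carrierE simp: L2_hnorm)
  then show "0 \<le> hdist (L2 M) x y" by (simp add: hdist_def)
  show "hdist (L2 M) x y = hdist (L2 M) y x"
  proof (cases "x \<in> carrier (L2 M) \<and> y \<in> carrier (L2 M)")
    case True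
    then show ?thesis
      by (auto elim!: L2_carrierE simp: L2_hdist norm_minus_commute)
  qed (auto simp: hdist_def)
next
  fix x y assume "x \<in> carrier (L2 M)" "y \<in> carrier (L2 M)"
  then obtain f g where fg: "f \<in> L2_fun M" "g \<in> L2_fun M" "x = L2_class M f" "y = L2_class M g"
    by (metis L2_carrierE)
  have "(hdist (L2 M) x y = 0) \<longleftrightarrow> (\<integral>x. (cmod (f x - g x))\<^sup>2 \<partial>M) = 0"
    using fg by (simp add: L2_hdist)
  also have "\<dots> \<longleftrightarrow> (AE x in M. (cmod (f x - g x))\<^sup>2 = 0)"
    using fg by (intro integral_nonneg_eq_0_iff_AE L2_fun_integrable L2_fun_diff) auto
  also have "\<dots> \<longleftrightarrow> x = y"
    using fg by (simp add: L2_class_eq_iff)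
  finally show "(hdist (L2 M) x y = 0) = (x = y)" .
next
  fix x y z assume "x \<in> carrier (L2 M)" "y \<in> carrier (L2 M)" "z \<in> carrier (L2 M)"
  then obtain f g h where fgh: "f \<in> L2_fun M" "g \<in> L2_fun M" "h \<in> L2_fun M"
    "x = L2_class M f" "y = L2_class M g" "z = L2_class M h"
    by (metis L2_carrierE)
  show "hdist (L2 M) x z \<le> hdist (L2 M) x y + hdist (L2 M) y z"
    using L2_norm_triangle[OF L2_fun_diff[OF fgh(1,2)] L2_fun_diff[OF fgh(2,3)]] fgh
    by (simp add: L2_hdist)
qed

text \<open>Riesz--Fischer. Along a subsequence \<open>f (r k)\<close> whose increments \<open>d k\<close> satisfy
  \<open>\<parallel>d k\<parallel>\<^sup>2 \<le> 8\<^sup>-\<^sup>k\<close>, the series of all \<open>2\<^sup>k \<bar>d k\<bar>\<^sup>2\<close> is integrable, hence finite almost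
  everywhere; so \<open>d k\<close> decays geometrically and the subsequence converges almost everywhere.
  Fatou's lemma upgrades this to convergence in the mean.\<close>

lemma L2_fun_complete:
  fixes f :: "nat \<Rightarrow> 'm \<Rightarrow> complex"
  assumes f: "\<And>n. f n \<in> L2_fun M"
    and cauchy: "\<And>e. e > 0 \<Longrightarrow> \<exists>N. \<forall>m\<ge>N. \<forall>n\<ge>N. (\<integral>x. (cmod (f m x - f n x))\<^sup>2 \<partial>M) < e"
  shows "\<exists>g\<in>L2_fun M. \<forall>e>0. \<exists>N. \<forall>n\<ge>N. (\<integral>x. (cmod (f n x - g x))\<^sup>2 \<partial>M) \<le> e"
proof -
  have [measurable]: "f n \<in> borel_measurable M" for n
    using f by (rule L2_fun_measurable)
  obtain N where N: "\<And>k m n. m \<ge> N k \<Longrightarrow> n \<ge> N k \<Longrightarrow> (\<integral>x. (cmod (f m x - f n x))\<^sup>2 \<partial>M) < (1 / 8) ^ k"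
    using cauchy[of "(1 / 8) ^ k" for k] by (metis zero_less_divide_1_iff zero_less_numeral zero_less_power)
  \<comment> \<open>The sum makes \<open>r\<close> monotone and at least \<open>N\<close>; the summand \<open>k\<close> makes it unbounded.\<close>
  define r where "r k = (\<Sum>i\<le>k. N i) + k" for k
  have rN: "N k \<le> r k" "N k \<le> r (Suc k)" for k
    using member_le_sum[of k "{..k}" N] by (auto simp: r_def)
  define d where "d k x = f (r (Suc k)) x - f (r k) x" for k x
  have [measurable]: "d k \<in> borel_measurable M" for k unfolding d_def by measurable
  have dL2: "d k \<in> L2_fun M" for k unfolding d_def by (intro L2_fun_diff f)
  have "(\<integral>\<^sup>+x. (\<Sum>k. ennreal (2 ^ k * (cmod (d k x))\<^sup>2)) \<partial>M) = (\<Sum>k. \<integral>\<^sup>+x. ennreal (2 ^ k * (cmod (d k x))\<^sup>2) \<partial>M)"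
    by (intro nn_integral_suminf) auto
  also have "\<dots> \<le> (\<Sum>k. ennreal ((1 / 4) ^ k))"
  proof (intro suminf_le summableI)
    fix k
    have "(\<integral>\<^sup>+x. ennreal (2 ^ k * (cmod (d k x))\<^sup>2) \<partial>M) = ennreal (2 ^ k) * ennreal (\<integral>x. (cmod (d k x))\<^sup>2 \<partial>M)"
      using dL2[of k] by (simp add: ennreal_mult nn_integral_cmult nn_integral_L2_fun)
    also have "\<dots> \<le> ennreal (2 ^ k) * ennreal ((1 / 8) ^ k)"
      using N[OF rN(2) rN(1), of k] by (intro mult_left_mono ennreal_leI) (auto simp: d_def)
    also have "\<dots> = ennreal ((1 / 4) ^ k)"
      by (simp flip: ennreal_mult power_mult_distrib)
    finally show "(\<integral>\<^sup>+x. ennreal (2 ^ k * (cmod (d k x))\<^sup>2) \<partial>M) \<le> ennreal ((1 / 4) ^ k)" .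
  qed
  also have "\<dots> < \<infinity>"
    using summable_geometric[of "1 / 4 :: real"] by (subst suminf_ennreal2) auto
  finally have "AE x in M. (\<Sum>k. ennreal (2 ^ k * (cmod (d k x))\<^sup>2)) \<noteq> \<infinity>"
    by (intro nn_integral_noteq_infinite) auto
  then have conv: "AE x in M. convergent (\<lambda>k. f (r k) x)"
  proof eventually_elim
    fix x assume fin: "(\<Sum>k. ennreal (2 ^ k * (cmod (d k x))\<^sup>2)) \<noteq> \<infinity>"
    define C where "C = enn2real (\<Sum>k. ennreal (2 ^ k * (cmod (d k x))\<^sup>2))"
    have "norm (d k x) \<le> sqrt C * (1 / sqrt 2) ^ k" for k
    proof -
      have "(\<Sum>k\<in>{k}. ennreal (2 ^ k * (cmod (d k x))\<^sup>2)) \<le> (\<Sum>k. ennreal (2 ^ k * (cmod (d k x))\<^sup>2))"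
        by (rule sum_le_suminf) (rule summableI, rule finite.insertI, rule finite.emptyI, rule zero_le)
      also have "\<dots> = ennreal C" using fin by (simp add: C_def less_top)
      finally have "ennreal (2 ^ k * (cmod (d k x))\<^sup>2) \<le> ennreal C" by simp
      moreover have "C \<ge> 0" by (simp add: C_def)
      ultimately have "2 ^ k * (cmod (d k x))\<^sup>2 \<le> C" by (simp only: ennreal_le_iff)
      then have "(cmod (d k x))\<^sup>2 \<le> C * (1 / 2) ^ k"
        by (simp add: field_simps)
      then have "sqrt ((cmod (d k x))\<^sup>2) \<le> sqrt (C * (1 / 2) ^ k)"
        by (rule real_sqrt_le_mono)
      then show ?thesis by (simp add: real_sqrt_mult real_sqrt_power real_sqrt_divide)
    qed
    moreover have "summable (\<lambda>k. sqrt C * (1 / sqrt 2) ^ k)"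
      by (intro summable_mult summable_geometric) simp
    ultimately have "summable (\<lambda>k. d k x)"
      by (rule summable_comparison_test'[rotated])
    then have "convergent (\<lambda>n. \<Sum>k<n. d k x)"
      by (simp add: summable_iff_convergent)
    moreover have "(\<Sum>k<n. d k x) = f (r n) x - f (r 0) x" for n
      unfolding d_def by (rule sum_lessThan_telescope)
    ultimately have "convergent (\<lambda>n. f (r n) x - f (r 0) x)" by simp
    from convergent_add[OF this convergent_const[of "f (r 0) x"]]
    show "convergent (\<lambda>k. f (r k) x)" by simp
  qed
  define g where "g x = lim (\<lambda>k. f (r k) x)" for x
  have gm [measurable]: "g \<in> borel_measurable M"
    unfolding g_def by (rule borel_measurable_lim_metric) auto
  have le: "(\<integral>\<^sup>+x. ennreal ((cmod (f n x - g x))\<^sup>2) \<partial>M) \<le> ennreal e"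
    if e: "\<And>m. m \<ge> K \<Longrightarrow> (\<integral>x. (cmod (f n x - f m x))\<^sup>2 \<partial>M) < e" for e n K
  proof -
    have "(\<integral>\<^sup>+x. ennreal ((cmod (f n x - g x))\<^sup>2) \<partial>M)
        = (\<integral>\<^sup>+x. liminf (\<lambda>k. ennreal ((cmod (f n x - f (r k) x))\<^sup>2)) \<partial>M)"
    proof (intro nn_integral_cong_AE, use conv in eventually_elim)
      fix x assume "convergent (\<lambda>k. f (r k) x)"
      then have "(\<lambda>k. f (r k) x) \<longlonglongrightarrow> g x" by (simp add: g_def convergent_LIMSEQ_iff)
      then have "(\<lambda>k. ennreal ((cmod (f n x - f (r k) x))\<^sup>2)) \<longlonglongrightarrow> ennreal ((cmod (f n x - g x))\<^sup>2)"
        by (intro tendsto_intros)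
      then show "ennreal ((cmod (f n x - g x))\<^sup>2) = liminf (\<lambda>k. ennreal ((cmod (f n x - f (r k) x))\<^sup>2))"
        by (rule lim_imp_Liminf[OF sequentially_bot, symmetric])
    qed
    also have "\<dots> \<le> liminf (\<lambda>k. \<integral>\<^sup>+x. ennreal ((cmod (f n x - f (r k) x))\<^sup>2) \<partial>M)"
      by (rule nn_integral_liminf) measurable
    also have "\<dots> \<le> liminf (\<lambda>k::nat. ennreal e)"
    proof (intro Liminf_mono eventually_sequentiallyI[of K])
      fix k assume "K \<le> k"
      then have "r k \<ge> K" by (simp add: r_def)
      then show "(\<integral>\<^sup>+x. ennreal ((cmod (f n x - f (r k) x))\<^sup>2) \<partial>M) \<le> ennreal e"
        using nn_integral_L2_fun[OF L2_fun_diff[OF f f], of n "r k"] e[of "r k"] by (simp add: ennreal_leI)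
    qed
    also have "\<dots> = ennreal e" by (simp add: Liminf_const)
    finally show ?thesis .
  qed
  have diff: "(\<lambda>x. f n x - g x) \<in> L2_fun M"
    if "\<And>m. m \<ge> K \<Longrightarrow> (\<integral>x. (cmod (f n x - f m x))\<^sup>2 \<partial>M) < e" for e n K
    unfolding L2_fun_iff_nn_integral
    using le_less_trans[OF le[of K n e, OF that] ennreal_less_top] by simp
  obtain K where K: "\<forall>m\<ge>K. \<forall>n\<ge>K. (\<integral>x. (cmod (f m x - f n x))\<^sup>2 \<partial>M) < 1"
    using cauchy[of 1] by auto
  have "(\<lambda>x. f K x - (f K x - g x)) \<in> L2_fun M"
    using K by (intro L2_fun_diff f diff[of K K 1]) auto
  then have gL2: "g \<in> L2_fun M" by simp
  show ?thesis
  proof (intro bexI[of _ g] allI impI)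
    fix e :: real assume e: "e > 0"
    then obtain K where K: "\<forall>m\<ge>K. \<forall>n\<ge>K. (\<integral>x. (cmod (f m x - f n x))\<^sup>2 \<partial>M) < e"
      using cauchy by blast
    have "(\<integral>x. (cmod (f n x - g x))\<^sup>2 \<partial>M) \<le> e" if "n \<ge> K" for n
      using le[of K n e] K that e nn_integral_L2_fun[OF L2_fun_diff[OF f gL2], of n] by simp
    then show "\<exists>N. \<forall>n\<ge>N. (\<integral>x. (cmod (f n x - g x))\<^sup>2 \<partial>M) \<le> e" by blast
  qed fact
qed

theorem complex_hilbert_space_L2: "complex_hilbert_space (L2 M)"
proof (intro complex_hilbert_space.intro complex_hilbert_space_axioms.intro L2.complex_inner_space_axioms)
  interpret Metric_space "carrier (L2 M)" "hdist (L2 M)" by (rule Metric_space_L2)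
  show mcomplete
    unfolding mcomplete_def
  proof (intro allI impI)
    fix \<sigma> assume c: "MCauchy \<sigma>"
    then have "\<forall>n. \<sigma> n \<in> carrier (L2 M)" by (auto simp: MCauchy_def)
    then have "\<forall>n. \<exists>f. f \<in> L2_fun M \<and> \<sigma> n = L2_class M f" by (auto simp: carrier_L2)
    then obtain f where f: "\<And>n. f n \<in> L2_fun M" "\<And>n. \<sigma> n = L2_class M (f n)" by metis
    have "\<exists>N. \<forall>m\<ge>N. \<forall>n\<ge>N. (\<integral>x. (cmod (f m x - f n x))\<^sup>2 \<partial>M) < e" if "e > 0" for e
    proof -
      have "sqrt e > 0" using that by simp
      with c obtain N where "\<And>m n. m \<ge> N \<Longrightarrow> n \<ge> N \<Longrightarrow> hdist (L2 M) (\<sigma> m) (\<sigma> n) < sqrt e"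
        unfolding MCauchy_def by meson
      then show ?thesis using f by (auto simp: L2_hdist)
    qed
    from L2_fun_complete[OF f(1) this] obtain g where g: "g \<in> L2_fun M"
      "\<And>e. e > 0 \<Longrightarrow> \<exists>N. \<forall>n\<ge>N. (\<integral>x. (cmod (f n x - g x))\<^sup>2 \<partial>M) \<le> e" by blast
    have "\<exists>N. \<forall>n\<ge>N. \<sigma> n \<in> carrier (L2 M) \<and> hdist (L2 M) (\<sigma> n) (L2_class M g) < e" if "e > 0" for e
    proof -
      have "(e / 2)\<^sup>2 > 0" using that by simp
      from g(2)[OF this]
      obtain N where N: "\<And>n. n \<ge> N \<Longrightarrow> (\<integral>x. (cmod (f n x - g x))\<^sup>2 \<partial>M) \<le> (e / 2)\<^sup>2"
        by blast
      have "sqrt (\<integral>x. (cmod (f n x - g x))\<^sup>2 \<partial>M) < e" if "n \<ge> N" for n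
        using real_sqrt_le_mono[OF N[OF that]] \<open>e > 0\<close> by simp
      then show ?thesis using f g by (auto simp: L2_hdist)
    qed
    then have "limitin mtopology \<sigma> (L2_class M g) sequentially"
      using g by (auto simp: limitin_metric eventually_sequentially)
    then show "\<exists>x. limitin mtopology \<sigma> x sequentially" ..
  qed
qed

section \<open>Iterated differences\<close>

text \<open>Powers of \<open>1 - E\<close> for the shift \<open>E f x = f (x + h)\<close>. With this sign the differences of a
  completely monotone function are nonnegative.\<close>

primrec ndiff :: "real \<Rightarrow> nat \<Rightarrow> (real \<Rightarrow> real) \<Rightarrow> real \<Rightarrow> real" where
  "ndiff h 0 f x = f x"
| "ndiff h (Suc n) f x = ndiff h n f x - ndiff h n f (x + h)"

lemma sum_choose_Suc:
  fixes a :: "nat \<Rightarrow> real"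
  shows "(\<Sum>k\<le>Suc n. real (Suc n choose k) * a k)
    = (\<Sum>k\<le>n. real (n choose k) * a k) + (\<Sum>k\<le>n. real (n choose k) * a (Suc k))"
proof -
  have "(\<Sum>k\<le>Suc n. real (Suc n choose k) * a k)
      = a 0 + (\<Sum>k\<le>n. real (n choose Suc k) * a (Suc k)) + (\<Sum>k\<le>n. real (n choose k) * a (Suc k))"
    by (simp only: sum.atMost_Suc_shift) (simp add: algebra_simps sum.distrib)
  also have "a 0 + (\<Sum>k\<le>n. real (n choose Suc k) * a (Suc k)) = (\<Sum>k\<le>Suc n. real (n choose k) * a k)"
    by (simp only: sum.atMost_Suc_shift) simp
  also have "\<dots> = (\<Sum>k\<le>n. real (n choose k) * a k)" by simp
  finally show ?thesis .
qed

lemma ndiff_eq_sum: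
  "ndiff h n f x = (\<Sum>k\<le>n. (- 1) ^ k * real (n choose k) * f (x + real k * h))"
proof (induction n arbitrary: x)
  case (Suc n)
  have "(\<Sum>k\<le>Suc n. real (Suc n choose k) * ((- 1) ^ k * f (x + real k * h)))
      = (\<Sum>k\<le>n. real (n choose k) * ((- 1) ^ k * f (x + real k * h)))
        + (\<Sum>k\<le>n. real (n choose k) * ((- 1) ^ Suc k * f (x + real (Suc k) * h)))"
    by (rule sum_choose_Suc)
  then show ?case
    by (simp add: Suc mult_ac algebra_simps sum_negf)
qed simp

text \<open>The Leibniz rule: \<open>(1 - E) (f g) = f \<cdot> (1 - E) g + (1 - E) f \<cdot> E g\<close>, iterated.\<close>

lemma ndiff_mult:
  "ndiff h n (\<lambda>x. f x * g x) x = (\<Sum>k\<le>n. real (n choose k) * (ndiff h k f x * ndiff h (n - k) g (x + real k * h)))"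
proof (induction n arbitrary: x)
  case (Suc n)
  have *: "ndiff h k f x * ndiff h (Suc n - k) g (x + real k * h)
      + ndiff h (Suc k) f x * ndiff h (n - k) g (x + real (Suc k) * h)
      = ndiff h k f x * ndiff h (n - k) g (x + real k * h)
      - ndiff h k f (x + h) * ndiff h (n - k) g (x + h + real k * h)" if "k \<le> n" for k
    using that by (simp add: Suc_diff_le algebra_simps)
  have "(\<Sum>k\<le>Suc n. real (Suc n choose k) * (ndiff h k f x * ndiff h (Suc n - k) g (x + real k * h)))
      = (\<Sum>k\<le>n. real (n choose k) * (ndiff h k f x * ndiff h (Suc n - k) g (x + real k * h)
          + ndiff h (Suc k) f x * ndiff h (n - k) g (x + real (Suc k) * h)))"
    by (simp only: sum_choose_Suc diff_Suc_Suc sum.distrib distrib_left)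
  also have "\<dots> = (\<Sum>k\<le>n. real (n choose k) * (ndiff h k f x * ndiff h (n - k) g (x + real k * h)
      - ndiff h k f (x + h) * ndiff h (n - k) g (x + h + real k * h)))"
    using * by (intro sum.cong refl) auto
  also have "\<dots> = ndiff h (Suc n) (\<lambda>x. f x * g x) x"
    by (simp add: Suc right_diff_distrib sum_subtractf)
  finally show ?case by (rule sym)
qed simp

lemma ndiff_const: "n \<ge> 1 \<Longrightarrow> ndiff h n (\<lambda>x. c) x = 0"
proof (induction n arbitrary: x)
  case (Suc n)
  then show ?case by (cases "n = 0") auto
qed simp

lemma ndiff_cong:
  assumes "\<And>x. x \<ge> 0 \<Longrightarrow> f x = g x" "x \<ge> 0" "h \<ge> 0"
  shows "ndiff h n f x = ndiff h n g x"
  using assms(2) by (induction n arbitrary: x) (auto simp: assms(1,3))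

text \<open>The difference \<open>\<nabla> = 1 - E\<close> and the shift satisfy \<open>(\<nabla> + E)\<^sup>m = 1\<close>. It is the Leibniz rule for the
  product of \<open>f\<close> with a point mass at \<open>x\<close>, all of whose differences are \<open>1\<close> at \<open>x\<close>.\<close>

lemma ndiff_partition_of_unity:
  assumes "h > 0"
  shows "(\<Sum>k\<le>m. real (m choose k) * ndiff h (m - k) f (x + real k * h)) = f x"
proof -
  have zero: "ndiff h k (\<lambda>y. if y = x then 1 else 0) y = 0" if "y > x" for k y
    using that assms by (induction k arbitrary: y) auto
  have one: "ndiff h k (\<lambda>y. if y = x then 1 else 0) x = 1" for k
    using assms zero[of "x + h"] by (induction k) auto
  have val: "ndiff h k (\<lambda>y. (if y = x then 1 else 0) * f y) x = f x" for k
  proof -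
    have z: "ndiff h k (\<lambda>y. (if y = x then 1 else 0) * f y) y = 0" if "y > x" for k y
      using that assms by (induction k arbitrary: y) auto
    show ?thesis using assms z[of "x + h"] by (induction k) auto
  qed
  show ?thesis
    using ndiff_mult[of h m "\<lambda>y. if y = x then 1 else 0" f x] by (simp add: one val)
qed

text \<open>In the Leibniz expansion of \<open>\<nabla>\<^sup>n (\<phi> \<cdot> 1/\<phi>) = 0\<close> every term except \<open>\<phi> \<cdot> \<nabla>\<^sup>n (1/\<phi>)\<close> is a
  product of a nonpositive difference of \<open>\<phi>\<close> with a lower, hence nonnegative, difference of
  \<open>1/\<phi>\<close>.\<close>

theorem ndiff_inverse_nonneg:
  assumes pos: "\<And>x. x \<ge> 0 \<Longrightarrow> \<phi> x > 0"
    and alt: "\<And>n x. n \<ge> 1 \<Longrightarrow> x \<ge> 0 \<Longrightarrow> ndiff h n \<phi> x \<le> 0"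
    and h: "h \<ge> 0" and x: "x \<ge> 0"
  shows "ndiff h n (\<lambda>x. 1 / \<phi> x) x \<ge> 0"
  using x
proof (induction n arbitrary: x rule: less_induct)
  case (less n)
  show ?case
  proof (cases "n = 0")
    case True
    then show ?thesis using pos[OF less.prems] by simp
  next
    case False
    let ?\<psi> = "\<lambda>x. 1 / \<phi> x"
    let ?a = "\<lambda>k. real (n choose k) * (ndiff h k \<phi> x * ndiff h (n - k) ?\<psi> (x + real k * h))"
    have "(\<Sum>k\<le>n. ?a k) = ndiff h n (\<lambda>x. \<phi> x * ?\<psi> x) x"
      by (rule ndiff_mult[symmetric])
    also have "\<dots> = ndiff h n (\<lambda>x. 1) x"
      using pos less.prems h by (intro ndiff_cong) (auto simp: less_imp_neq[symmetric])
    also have "\<dots> = 0" using False by (simp add: ndiff_const)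
    finally have "?a 0 + (\<Sum>k\<in>{..n} - {0}. ?a k) = 0"
      using sum.remove[of "{..n}" 0 ?a] by simp
    moreover have "(\<Sum>k\<in>{..n} - {0}. ?a k) \<le> 0"
    proof (rule sum_nonpos)
      fix k assume "k \<in> {..n} - {0}"
      then have k: "1 \<le> k" "n - k < n" by auto
      have "ndiff h k \<phi> x \<le> 0" using k less.prems by (intro alt)
      moreover have "ndiff h (n - k) ?\<psi> (x + real k * h) \<ge> 0"
        using k less.prems h by (intro less.IH) auto
      ultimately show "?a k \<le> 0"
        by (intro mult_nonneg_nonpos[OF of_nat_0_le_iff] mult_nonpos_nonneg)
    qed
    ultimately have "\<phi> x * ndiff h n ?\<psi> x \<ge> 0" by simp
    then show ?thesis using pos[OF less.prems] by (simp add: zero_le_mult_iff)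
  qed
qed

section \<open>Bernstein's theorem\<close>

lemma binomial_ratio_prod:
  assumes "j \<le> n"
  shows "real (k choose j) / real (n choose j) = (\<Prod>i<j. (real k - real i) / (real n - real i))"
  by (simp add: binomial_gbinomial gbinomial_prod_rev prod_dividef atLeast0LessThan)

text \<open>Both quantities compared are products of \<open>j\<close> factors of modulus at most one, and corresponding factors differ by
  at most \<open>2 j / n\<close>.\<close>

lemma binomial_ratio_approx:
  assumes k: "k \<le> n" and j: "2 * j \<le> n" and n: "n > 0"
  shows "\<bar>(real k / real n) ^ j - real (k choose j) / real (n choose j)\<bar> \<le> 2 * (real j)\<^sup>2 / real n"
proof -
  have "norm ((\<Prod>i<j. real k / real n) - (\<Prod>i<j. (real k - real i) / (real n - real i)))
      \<le> (\<Sum>i<j. norm (real k / real n - (real k - real i) / (real n - real i)))"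
  proof (rule norm_prod_diff)
    fix i assume "i \<in> {..<j}"
    then have "\<bar>real k - real i\<bar> \<le> real n - real i" "real n - real i > 0"
      using k j by auto
    then show "norm ((real k - real i) / (real n - real i)) \<le> 1"
      by (simp add: divide_le_eq)
  qed (use k n in auto)
  also have "\<dots> \<le> (\<Sum>i<j. 2 * real j / real n)"
  proof (rule sum_mono)
    fix i assume i: "i \<in> {..<j}"
    then have pos: "real n - real i > 0" "2 * (real n - real i) \<ge> real n" using j by auto
    have "real k / real n - (real k - real i) / (real n - real i)
        = real i * (real n - real k) / (real n * (real n - real i))"
      using pos n by (simp add: field_simps)
    moreover have "\<bar>\<dots>\<bar> \<le> 2 * real j / real n"
    proof -
      have "real i * (real n - real k) \<le> real j * real n"
        using i k by (intro mult_mono) auto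
      also have "\<dots> \<le> real j * (2 * (real n - real i))"
        using pos by (intro mult_left_mono) auto
      finally have "real i * (real n - real k) \<le> 2 * real j * (real n - real i)" by (simp only: mult_ac)
      then have "real i * (real n - real k) * real n \<le> 2 * real j * (real n - real i) * real n"
        by (rule mult_right_mono) simp
      moreover have "0 \<le> real i * (real n - real k) / (real n * (real n - real i))"
        using pos k by (intro divide_nonneg_nonneg mult_nonneg_nonneg) auto
      ultimately show ?thesis
        using pos n by (simp add: divide_le_eq le_divide_eq mult_ac)
    qed
    ultimately show "norm (real k / real n - (real k - real i) / (real n - real i)) \<le> 2 * real j / real n"
      by simp
  qed
  also have "\<dots> = 2 * (real j)\<^sup>2 / real n" by (simp add: power2_eq_square)
  finally show ?thesis using j by (simp add: binomial_ratio_prod)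
qed

text \<open>With \<open>u = exp (- s)\<close> this follows from \<open>1 - u \<le> s\<close> and \<open>a s \<le> exp (a s)\<close>.\<close>

lemma powr_one_minus_le:
  fixes u a :: real
  assumes "0 \<le> u" "u \<le> 1" "a > 0"
  shows "u powr a * (1 - u) \<le> 1 / a"
proof (cases "u = 0")
  case False
  with assms have u: "u > 0" by simp
  have "1 - u \<le> - ln u" using ln_le_minus_one[OF u] by simp
  then have "u powr a * (1 - u) \<le> u powr a * (- ln u)" by (intro mult_left_mono) auto
  also have "\<dots> = (u powr a * (a * - ln u)) / a" using assms by simp
  also have "\<dots> \<le> (u powr a * exp (a * - ln u)) / a"
    using exp_ge_add_one_self[of "a * - ln u"] assms by (intro divide_right_mono mult_left_mono) auto
  also have "\<dots> = 1 / a" using u by (simp add: powr_def flip: exp_add)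
  finally show ?thesis .
qed (use assms in auto)

text \<open>On the unit interval the error is at most \<open>u powr a * (1 - u)\<close>, which is small for large \<open>a\<close>
  uniformly in \<open>u\<close>.\<close>

lemma powr_ceiling_approx:
  fixes u a :: real
  assumes u: "0 \<le> u" "u \<le> 1" and a: "a > 0"
  shows "\<bar>u powr a - u ^ nat \<lceil>a\<rceil>\<bar> \<le> 1 / a"
proof (cases "u = 0")
  case True
  moreover have "nat \<lceil>a\<rceil> > 0" using a by simp
  ultimately show ?thesis using a by (simp add: zero_power)
next
  case False
  then have u0: "u > 0" using u by simp
  define j where "j = nat \<lceil>a\<rceil>"
  have j: "a \<le> real j" "real j \<le> a + 1" using a unfolding j_def by linarith+
  have eq: "u ^ j = u powr a * u powr (real j - a)"
    using u0 by (simp add: powr_realpow flip: powr_add)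
  have b: "u \<le> u powr (real j - a)" "u powr (real j - a) \<le> 1"
    using u u0 j powr_mono'[of "real j - a" 1 u] powr_mono'[of 0 "real j - a" u] by auto
  have "u powr a - u ^ j = u powr a * (1 - u powr (real j - a))"
    by (simp add: eq algebra_simps)
  moreover have "0 \<le> u powr a * (1 - u powr (real j - a))" using b by simp
  moreover have "u powr a * (1 - u powr (real j - a)) \<le> u powr a * (1 - u)"
    using b by (intro mult_left_mono) auto
  ultimately show ?thesis using powr_one_minus_le[OF u a] unfolding j_def by linarith
qed

text \<open>Truncation makes \<open>u \<mapsto> u powr x\<close> a bounded continuous function on the whole line for \<open>x > 0\<close>, as
  weak convergence of distributions on the line demands of test functions.\<close>

definition clamp01 :: "real \<Rightarrow> real" where "clamp01 u = max 0 (min 1 u)"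

lemma clamp01: "0 \<le> clamp01 u" "clamp01 u \<le> 1"
  by (auto simp: clamp01_def)

lemma clamp01_measurable [measurable]: "clamp01 \<in> borel_measurable borel"
  unfolding clamp01_def by measurable

lemma isCont_clamp01_powr: "x > 0 \<Longrightarrow> isCont (\<lambda>u. clamp01 u powr x) u"
  unfolding clamp01_def
  by (intro continuous_intros) auto

text \<open>Hausdorff's identity: since \<open>(n choose k) (k choose j) = (n choose j) (n - j choose k - j)\<close>, the sum
  is the expansion of \<open>1 = (\<nabla> + E)\<^sup>n\<^sup>-\<^sup>j\<close> at the point \<open>j h\<close>. As \<open>(k choose j) / (n choose j)\<close> is close to
  \<open>(k / n)\<^sup>j\<close>, it says that the measure with these weights at the points \<open>k / n\<close> has moments close to
  \<open>\<psi> (j h)\<close>.\<close>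

lemma hausdorff_weights:
  fixes \<psi> :: "real \<Rightarrow> real"
  assumes h: "h > 0" and j: "j \<le> n"
  shows "(\<Sum>k\<le>n. real (n choose k) * ndiff h (n - k) \<psi> (real k * h) * (real (k choose j) / real (n choose j)))
    = \<psi> (real j * h)"
proof -
  let ?w = "\<lambda>k. real (n choose k) * ndiff h (n - k) \<psi> (real k * h) * (real (k choose j) / real (n choose j))"
  have "(\<Sum>k\<le>n. ?w k) = (\<Sum>k\<in>{j..n}. ?w k)"
    by (rule sum.mono_neutral_right) (auto simp: binomial_eq_0)
  also have "\<dots> = (\<Sum>i\<le>n - j. ?w (i + j))"
    using sum.shift_bounds_cl_nat_ivl[of ?w 0 j "n - j"] j by (simp add: atMost_atLeast0)
  also have "\<dots> = (\<Sum>i\<le>n - j. real (n - j choose i) * ndiff h (n - j - i) \<psi> (real j * h + real i * h))"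
  proof (rule sum.cong[OF refl])
    fix i assume i: "i \<in> {..n - j}"
    have "(n choose (i + j)) * ((i + j) choose j) = (n choose j) * ((n - j) choose i)"
      using choose_mult[of j "i + j" n] i j by simp
    then have "real (n choose (i + j)) * real ((i + j) choose j) = real (n choose j) * real ((n - j) choose i)"
      by (metis of_nat_mult)
    moreover have "real (n choose j) \<noteq> 0" using j by simp
    ultimately have "real (n choose (i + j)) * (real ((i + j) choose j) / real (n choose j)) = real ((n - j) choose i)"
      by (simp add: field_simps)
    moreover have "n - (i + j) = n - j - i" "real (i + j) * h = real j * h + real i * h"
      by (auto simp: algebra_simps)
    moreover have "?w (i + j) = real (n choose (i + j)) * (real ((i + j) choose j) / real (n choose j))
        * ndiff h (n - (i + j)) \<psi> (real (i + j) * h)"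
      by (simp only: mult_ac)
    ultimately show "?w (i + j) = real (n - j choose i) * ndiff h (n - j - i) \<psi> (real j * h + real i * h)"
      by simp
  qed
  also have "\<dots> = \<psi> (real j * h)" by (rule ndiff_partition_of_unity[OF h])
  finally show ?thesis .
qed

text \<open>In the variable \<open>u = exp (- s)\<close> this is the representation of a completely monotone function as the
  Laplace transform of a measure. The probability measures \<open>\<mu> m\<close> put the normalized weights of
  \<open>hausdorff_weights\<close>, for step \<open>1 / N\<close> and order \<open>N\<^sup>3\<close>, at the points \<open>(k / N\<^sup>3)\<^sup>N\<close>; the \<open>N\<close>-th power turns
  moments of order \<open>j\<close> into moments of order \<open>j / N\<close>. Order \<open>N\<^sup>3\<close> beats the error \<open>2 j\<^sup>2 / n\<close> of
  \<open>binomial_ratio_approx\<close>, where \<open>j\<close> grows like \<open>x N\<close>. Helly's theorem produces a weak limit. For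
  \<open>x = 0\<close> the test function jumps at \<open>u = 0\<close>, because \<open>0 powr 0 = 0\<close>, and weak convergence says nothing
  about its integral.\<close>

theorem bernstein:
  fixes \<psi> :: "real \<Rightarrow> real"
  assumes cont: "continuous_on {0..} \<psi>" and pos: "\<psi> 0 > 0"
    and cm: "\<And>h n x. h > 0 \<Longrightarrow> x \<ge> 0 \<Longrightarrow> ndiff h n \<psi> x \<ge> 0"
  shows "\<exists>M. real_distribution M \<and> (\<forall>x>0. (\<integral>u. clamp01 u powr x \<partial>M) = \<psi> x / \<psi> 0)"
proof -
  define N where "N m = Suc m" for m :: nat
  define n where "n m = N m ^ 3" for m
  define p where "p m k = real (n m choose k) * ndiff (1 / real (N m)) (n m - k) \<psi> (real k * (1 / real (N m))) / \<psi> 0" for m k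
  define s where "s m k = (real k / real (n m)) ^ N m" for m k
  define \<mu> where "\<mu> m = distr (point_measure {..n m} (\<lambda>k. ennreal (p m k))) borel (s m)" for m
  have N: "N m > 0" for m by (simp add: N_def)
  have n: "n m > 0" for m by (simp add: n_def N_def)
  have p0: "p m k \<ge> 0" for m k
    using pos N[of m] unfolding p_def by (intro divide_nonneg_pos mult_nonneg_nonneg cm) auto
  have mom: "(\<Sum>k\<le>n m. p m k * (real (k choose j) / real (n m choose j))) = \<psi> (real j / real (N m)) / \<psi> 0"
    if "j \<le> n m" for m j
  proof -
    have "(\<Sum>k\<le>n m. p m k * (real (k choose j) / real (n m choose j)))
        = (\<Sum>k\<le>n m. real (n m choose k) * ndiff (1 / real (N m)) (n m - k) \<psi> (real k * (1 / real (N m)))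
            * (real (k choose j) / real (n m choose j))) / \<psi> 0"
      unfolding p_def sum_divide_distrib by (intro sum.cong refl) (simp add: mult_ac)
    also have "\<dots> = \<psi> (real j * (1 / real (N m))) / \<psi> 0"
      using that N[of m] by (subst hausdorff_weights) auto
    finally show ?thesis by simp
  qed
  have p1: "(\<Sum>k\<le>n m. p m k) = 1" for m
    using mom[of 0 m] pos by simp
  have sm [measurable]: "s m \<in> measurable (point_measure {..n m} (\<lambda>k. ennreal (p m k))) borel" for m
    by (simp add: measurable_def space_point_measure sets_point_measure)
  have ps: "prob_space (point_measure {..n m} (\<lambda>k. ennreal (p m k)))" for m
    using p0 p1 by (intro prob_space_point_measure) auto
  have rd: "real_distribution (\<mu> m)" for m
    unfolding \<mu>_def real_distribution_def real_distribution_axioms_def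
    using prob_space.prob_space_distr[OF ps sm] by simp
  have s01: "0 \<le> s m k" "k \<le> n m \<Longrightarrow> s m k \<le> 1" for m k
    using n[of m] by (auto simp: s_def intro!: power_le_one)
  have int: "(\<integral>u. f u \<partial>\<mu> m) = (\<Sum>k\<le>n m. p m k * f (s m k))"
    if [measurable]: "f \<in> borel_measurable borel" for f :: "real \<Rightarrow> real" and m
    unfolding \<mu>_def using p0
    by (subst integral_distr[OF sm that]) (simp add: lebesgue_integral_point_measure_finite)
  have mass: "measure (\<mu> m) {-1<..1} = 1" for m
  proof -
    interpret real_distribution "\<mu> m" by (rule rd)
    have "measure (\<mu> m) {-1<..1} = (\<integral>u. indicator {-1<..1} u \<partial>\<mu> m)"
      by simp
    also have "\<dots> = (\<Sum>k\<le>n m. p m k * indicator {-1<..1} (s m k))"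
      by (rule int) simp
    also have "\<dots> = (\<Sum>k\<le>n m. p m k)"
    proof (rule sum.cong[OF refl])
      fix k assume "k \<in> {..n m}"
      then have "s m k \<in> {-1<..1}" using s01[where m = m and k = k] by auto
      then show "p m k * indicator {-1<..1} (s m k) = p m k" by simp
    qed
    finally show ?thesis by (simp add: p1)
  qed
  have "tight \<mu>"
    unfolding tight_def
  proof (intro conjI allI impI rd)
    fix e :: real assume "e > 0"
    then show "\<exists>a b. a < b \<and> (\<forall>n. 1 - e < measure (\<mu> n) {a<..b})"
      by (intro exI[of _ "-1"] exI[of _ 1]) (simp add: mass)
  qed
  from tight_imp_convergent_subsubsequence[OF this strict_mono_id]
  obtain r M where r: "strict_mono (r :: nat \<Rightarrow> nat)" and M: "real_distribution M"
    and wc: "weak_conv_m (\<lambda>m. \<mu> (r m)) M"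
    by (auto simp: o_def)
  have "(\<integral>u. clamp01 u powr x \<partial>M) = \<psi> x / \<psi> 0" if x: "x > 0" for x
  proof -
    define j where "j m = nat \<lceil>x * real (N m)\<rceil>" for m
    have jb: "x * real (N m) \<le> real (j m)" "real (j m) \<le> x * real (N m) + 1" for m
    proof -
      have "x * real (N m) > 0" using x N[of m] by simp
      then show "x * real (N m) \<le> real (j m)" "real (j m) \<le> x * real (N m) + 1"
        unfolding j_def by linarith+
    qed
    have main: "\<bar>(\<integral>u. clamp01 u powr x \<partial>\<mu> m) - \<psi> (real (j m) / real (N m)) / \<psi> 0\<bar>
        \<le> 1 / (x * real (N m)) + 2 * (real (j m))\<^sup>2 / real (n m)" if jn: "2 * j m \<le> n m" for m
    proof -
      have "(\<integral>u. clamp01 u powr x \<partial>\<mu> m) - \<psi> (real (j m) / real (N m)) / \<psi> 0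
          = (\<Sum>k\<le>n m. p m k * (clamp01 (s m k) powr x - real (k choose j m) / real (n m choose j m)))"
        using mom[of "j m" m] jn by (subst int) (auto simp: right_diff_distrib sum_subtractf)
      also have "\<bar>\<dots>\<bar> \<le> (\<Sum>k\<le>n m. p m k * (1 / (x * real (N m)) + 2 * (real (j m))\<^sup>2 / real (n m)))"
      proof (intro order_trans[OF sum_abs] sum_mono)
        fix k assume k: "k \<in> {..n m}"
        define u where "u = real k / real (n m)"
        have u: "0 \<le> u" "u \<le> 1" using k n[of m] by (auto simp: u_def)
        have "clamp01 (s m k) = u ^ N m"
          using s01[where m = m and k = k] k by (auto simp: clamp01_def u_def s_def)
        also have "\<dots> powr x = u powr (x * real (N m))"
        proof (cases "u = 0")
          case False
          then have "u ^ N m = u powr real (N m)" using u by (simp add: powr_realpow)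
          then show ?thesis by (simp add: powr_powr mult.commute)
        qed (use N[of m] in auto)
        finally have c: "clamp01 (s m k) powr x = u powr (x * real (N m))" .
        have "\<bar>u powr (x * real (N m)) - u ^ j m\<bar> \<le> 1 / (x * real (N m))"
          unfolding j_def using u x N[of m] by (intro powr_ceiling_approx) auto
        moreover have "\<bar>u ^ j m - real (k choose j m) / real (n m choose j m)\<bar> \<le> 2 * (real (j m))\<^sup>2 / real (n m)"
          unfolding u_def using k jn n by (intro binomial_ratio_approx) auto
        ultimately have "\<bar>clamp01 (s m k) powr x - real (k choose j m) / real (n m choose j m)\<bar>
            \<le> 1 / (x * real (N m)) + 2 * (real (j m))\<^sup>2 / real (n m)"
          unfolding c by linarith
        then show "\<bar>p m k * (clamp01 (s m k) powr x - real (k choose j m) / real (n m choose j m))\<bar>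
            \<le> p m k * (1 / (x * real (N m)) + 2 * (real (j m))\<^sup>2 / real (n m))"
          using p0[of m k] by (simp add: abs_mult mult_left_mono)
      qed
      also have "\<dots> = 1 / (x * real (N m)) + 2 * (real (j m))\<^sup>2 / real (n m)"
        by (simp add: p1 flip: sum_distrib_right)
      finally show ?thesis .
    qed
    have Nlim: "filterlim (\<lambda>m. real (N m)) at_top sequentially"
      unfolding N_def by (rule filterlim_compose[OF filterlim_real_sequentially filterlim_Suc])
    have jlim: "(\<lambda>m. real (j m) / real (N m)) \<longlonglongrightarrow> x"
    proof (rule tendsto_sandwich)
      show "\<forall>\<^sub>F m in sequentially. x \<le> real (j m) / real (N m)"
        using jb N by (auto simp: le_divide_eq)
      show "\<forall>\<^sub>F m in sequentially. real (j m) / real (N m) \<le> x + 1 / real (N m)"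
      proof (intro always_eventually allI)
        fix m
        have "real (j m) / real (N m) \<le> (x * real (N m) + 1) / real (N m)"
          by (intro divide_right_mono jb) simp
        then show "real (j m) / real (N m) \<le> x + 1 / real (N m)"
          using N[of m] by (simp add: add_divide_distrib)
      qed
      have "(\<lambda>m. x + 1 / real (N m)) \<longlonglongrightarrow> x + 0"
        by (intro tendsto_add tendsto_const tendsto_divide_0[OF tendsto_const] filterlim_at_top_imp_at_infinity Nlim)
      then show "(\<lambda>m. x + 1 / real (N m)) \<longlonglongrightarrow> x" by simp
    qed simp
    have err: "(\<lambda>m. 1 / (x * real (N m)) + 2 * (real (j m))\<^sup>2 / real (n m)) \<longlonglongrightarrow> 0"
    proof -
      have "(\<lambda>m. 1 / x * (1 / real (N m)) + 2 * (real (j m) / real (N m))\<^sup>2 * (1 / real (N m))) \<longlonglongrightarrow> 1 / x * 0 + 2 * x\<^sup>2 * 0"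
        by (intro tendsto_intros jlim tendsto_divide_0[OF tendsto_const] filterlim_at_top_imp_at_infinity Nlim)
      also have "(\<lambda>m. 1 / x * (1 / real (N m)) + 2 * (real (j m) / real (N m))\<^sup>2 * (1 / real (N m)))
          = (\<lambda>m. 1 / (x * real (N m)) + 2 * (real (j m))\<^sup>2 / real (n m))"
        by (auto simp: n_def power2_eq_square power3_eq_cube)
      finally show ?thesis by simp
    qed
    have "\<forall>\<^sub>F m in sequentially. real (N m) \<ge> 2 * (x + 1)"
      using Nlim by (simp add: filterlim_at_top)
    then have jn: "\<forall>\<^sub>F m in sequentially. 2 * j m \<le> n m"
    proof eventually_elim
      fix m assume "real (N m) \<ge> 2 * (x + 1)"
      have N1: "real (N m) \<ge> 1" using N[of m] by simp
      have "2 * real (j m) \<le> 2 * (x * real (N m) + 1)" using jb[where m = m] by simp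
      also have "\<dots> \<le> 2 * (x + 1) * real (N m)" using N1 by (simp add: algebra_simps)
      also have "\<dots> \<le> real (N m) * real (N m)"
        using \<open>real (N m) \<ge> 2 * (x + 1)\<close> by (intro mult_right_mono) auto
      also have "\<dots> \<le> real (N m) * real (N m) * real (N m)"
        using N1 by (simp add: mult_le_cancel_left1)
      also have "\<dots> = real (n m)" by (simp add: n_def power3_eq_cube)
      finally show "2 * j m \<le> n m" by linarith
    qed
    have "(\<lambda>m. (\<integral>u. clamp01 u powr x \<partial>\<mu> m) - \<psi> (real (j m) / real (N m)) / \<psi> 0) \<longlonglongrightarrow> 0"
      by (rule Lim_null_comparison[OF _ err], use jn in eventually_elim) (use main in auto)
    moreover have "(\<lambda>m. \<psi> (real (j m) / real (N m)) / \<psi> 0) \<longlonglongrightarrow> \<psi> x / \<psi> 0"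
      using x pos by (intro tendsto_divide tendsto_const continuous_on_tendsto_compose[OF cont jlim]) auto
    ultimately have "(\<lambda>m. (\<integral>u. clamp01 u powr x \<partial>\<mu> m)) \<longlonglongrightarrow> \<psi> x / \<psi> 0"
      using tendsto_add by fastforce
    then have "(\<lambda>m. (\<integral>u. clamp01 u powr x \<partial>\<mu> (r m))) \<longlonglongrightarrow> \<psi> x / \<psi> 0"
      using LIMSEQ_subseq_LIMSEQ[OF _ r] by (fastforce simp: o_def)
    moreover have "(\<lambda>m. (\<integral>u. clamp01 u powr x \<partial>\<mu> (r m))) \<longlonglongrightarrow> (\<integral>u. clamp01 u powr x \<partial>M)"
    proof (rule weak_conv_imp_integral_bdd_continuous_conv)
      show "norm (clamp01 u powr x) \<le> 1" for u
        using clamp01[of u] x powr_le1[of x "clamp01 u"] by simp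
    qed (use rd M wc x isCont_clamp01_powr in auto)
    ultimately show ?thesis
      using LIMSEQ_unique by fastforce
  qed
  with M show ?thesis by blast
qed

section \<open>Operators agreeing on the carrier, contractions\<close>

lemma bounded_operator_cong:
  assumes "complex_inner_space H" "\<And>x. x \<in> carrier H \<Longrightarrow> T x = T' x" "bounded_operator H T'"
  shows "bounded_operator H T"
proof -
  interpret complex_inner_space H by fact
  show ?thesis
    using assms(2,3) unfolding bounded_operator_def linear_map_def by (auto simp: Pi_iff)
qed

lemma subnormal_cong:
  assumes "complex_inner_space H" "\<And>x. x \<in> carrier H \<Longrightarrow> T x = T' x" "subnormal H T'"
  shows "subnormal H T"
  using assms bounded_operator_cong[OF assms(1,2)] unfolding subnormal_def by auto

lemma contraction_cong:
  assumes "complex_inner_space H" "\<And>x. x \<in> carrier H \<Longrightarrow> T x = T' x" "contraction H T'"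
  shows "contraction H T"
proof -
  have "adj H T y = adj H T' y" for y
    unfolding adj_def using assms(2) by (simp cong: conj_cong ball_cong)
  then have "adj H T = adj H T'" by (rule ext)
  then show ?thesis
    using assms bounded_operator_cong[OF assms(1,2)] unfolding contraction_def op_le_def by auto
qed

lemma (in complex_inner_space) contractionI:
  assumes T: "bounded_operator H T" and B: "B \<in> carrier H \<rightarrow> carrier H"
    and adj: "\<And>x y. x \<in> carrier H \<Longrightarrow> y \<in> carrier H \<Longrightarrow> cinner H (T x) y = cinner H x (B y)"
    and le: "\<And>x. x \<in> carrier H \<Longrightarrow> (hnorm H (T x))\<^sup>2 \<le> (hnorm H x)\<^sup>2"
  shows "contraction H T"
  unfolding contraction_def op_le_def
proof (intro conjI ballI T)
  fix x assume x: "x \<in> carrier H"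
  have Tx: "T x \<in> carrier H" using T x by (auto simp: bounded_operator_def linear_map_def)
  then have BTx: "B (T x) \<in> carrier H" using B by auto
  have "adj H T (T x) = B (T x)" using adj Tx BTx by (intro adj_eqI) auto
  moreover have "cinner H (B (T x)) x = complex_of_real ((hnorm H (T x))\<^sup>2)"
    using cinner_commute[OF BTx x] adj[OF x Tx] hnorm_sq[OF Tx] by (metis complex_cnj_complex_of_real)
  ultimately have "cinner H (x \<ominus> adj H T (T x) \<ominus> \<zero>) x = complex_of_real ((hnorm H x)\<^sup>2 - (hnorm H (T x))\<^sup>2)"
    using x BTx by (simp only: cinner_minus_left M.minus_closed M.zero_closed cinner_zero_left hnorm_sq of_real_diff diff_zero)
  then show "cinner H (x \<ominus> adj H T (T x) \<ominus> \<zero>) x \<in> \<real>\<^sub>\<ge>\<^sub>0"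
    using le[OF x] by (simp only: nonneg_Reals_of_real_iff)
qed

section \<open>Weighted composition operators\<close>

text \<open>The weighted translations, their adjoints, the normal extension and the embedding of \<open>L\<^sup>2\<close> of the half
  line in the larger space all have this form.\<close>

definition wfun :: "('k \<Rightarrow> real) \<Rightarrow> ('k \<Rightarrow> 'm) \<Rightarrow> ('m \<Rightarrow> complex) \<Rightarrow> 'k \<Rightarrow> complex" where
  "wfun w \<tau> f y = complex_of_real (w y) * f (\<tau> y)"

definition wcomp :: "'k measure \<Rightarrow> ('k \<Rightarrow> real) \<Rightarrow> ('k \<Rightarrow> 'm) \<Rightarrow> ('m \<Rightarrow> complex) set \<Rightarrow> ('k \<Rightarrow> complex) set" where
  "wcomp M' w \<tau> F = L2_class M' (wfun w \<tau> (L2_rep F))"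

text \<open>The estimate is demanded of all measurable functions and not just of square-integrable ones. Applied
  to a null function it shows that the operator respects equality almost everywhere.\<close>

definition wcomp_bounded :: "'m measure \<Rightarrow> 'k measure \<Rightarrow> ('k \<Rightarrow> real) \<Rightarrow> ('k \<Rightarrow> 'm) \<Rightarrow> bool" where
  "wcomp_bounded M M' w \<tau> \<longleftrightarrow> (\<exists>C. \<forall>f\<in>borel_measurable M. wfun w \<tau> f \<in> borel_measurable M' \<and>
     (\<integral>\<^sup>+y. ennreal ((cmod (wfun w \<tau> f y))\<^sup>2) \<partial>M') \<le> ennreal C * (\<integral>\<^sup>+x. ennreal ((cmod (f x))\<^sup>2) \<partial>M))"

lemma wfun_add: "wfun w \<tau> (\<lambda>x. f x + g x) = (\<lambda>y. wfun w \<tau> f y + wfun w \<tau> g y)"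
  and wfun_cmult: "wfun w \<tau> (\<lambda>x. c * f x) = (\<lambda>y. c * wfun w \<tau> f y)"
  by (auto simp: wfun_def algebra_simps)

lemma wcomp_boundedI:
  assumes "\<And>f. f \<in> borel_measurable M \<Longrightarrow> wfun w \<tau> f \<in> borel_measurable M'"
    and "\<And>f. f \<in> borel_measurable M \<Longrightarrow> (\<integral>\<^sup>+y. ennreal ((cmod (wfun w \<tau> f y))\<^sup>2) \<partial>M')
      \<le> ennreal C * (\<integral>\<^sup>+x. ennreal ((cmod (f x))\<^sup>2) \<partial>M)"
  shows "wcomp_bounded M M' w \<tau>"
  unfolding wcomp_bounded_def using assms by blast

lemma wcomp_boundedE:
  assumes "wcomp_bounded M M' w \<tau>"
  obtains C where "C \<ge> 0"
    "\<And>f. f \<in> borel_measurable M \<Longrightarrow> wfun w \<tau> f \<in> borel_measurable M'"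
    "\<And>f. f \<in> borel_measurable M \<Longrightarrow> (\<integral>\<^sup>+y. ennreal ((cmod (wfun w \<tau> f y))\<^sup>2) \<partial>M')
      \<le> ennreal C * (\<integral>\<^sup>+x. ennreal ((cmod (f x))\<^sup>2) \<partial>M)"
proof -
  obtain C where C: "\<forall>f\<in>borel_measurable M. wfun w \<tau> f \<in> borel_measurable M' \<and>
     (\<integral>\<^sup>+y. ennreal ((cmod (wfun w \<tau> f y))\<^sup>2) \<partial>M') \<le> ennreal C * (\<integral>\<^sup>+x. ennreal ((cmod (f x))\<^sup>2) \<partial>M)"
    using assms unfolding wcomp_bounded_def by blast
  have "ennreal C = ennreal (max 0 C)" by (simp add: max_def ennreal_neg)
  with C show ?thesis by (intro that[of "max 0 C"]) auto
qed

lemma wfun_measurable: "wcomp_bounded M M' w \<tau> \<Longrightarrow> f \<in> borel_measurable M \<Longrightarrow> wfun w \<tau> f \<in> borel_measurable M'"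
  unfolding wcomp_bounded_def by blast

lemma wfun_L2:
  assumes "wcomp_bounded M M' w \<tau>" "f \<in> L2_fun M" shows "wfun w \<tau> f \<in> L2_fun M'"
proof -
  obtain C where C: "(\<integral>\<^sup>+y. ennreal ((cmod (wfun w \<tau> f y))\<^sup>2) \<partial>M') \<le> ennreal C * (\<integral>\<^sup>+x. ennreal ((cmod (f x))\<^sup>2) \<partial>M)"
    using assms(1) L2_fun_measurable[OF assms(2)] by (elim wcomp_boundedE) blast
  also have "\<dots> < \<infinity>" using assms(2) by (simp add: nn_integral_L2_fun ennreal_mult_less_top)
  finally show ?thesis
    using wfun_measurable[OF assms(1) L2_fun_measurable[OF assms(2)]] by (simp add: L2_fun_iff_nn_integral)
qed

lemma wfun_AE_eq:
  assumes b: "wcomp_bounded M M' w \<tau>" and f: "f \<in> L2_fun M" and g: "g \<in> L2_fun M"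
    and eq: "AE x in M. f x = g x"
  shows "AE y in M'. wfun w \<tau> f y = wfun w \<tau> g y"
proof -
  obtain C where C: "\<And>f. f \<in> borel_measurable M \<Longrightarrow> (\<integral>\<^sup>+y. ennreal ((cmod (wfun w \<tau> f y))\<^sup>2) \<partial>M')
      \<le> ennreal C * (\<integral>\<^sup>+x. ennreal ((cmod (f x))\<^sup>2) \<partial>M)"
    using b by (elim wcomp_boundedE) blast
  define h where "h x = f x - g x" for x
  have hm [measurable]: "h \<in> borel_measurable M"
    unfolding h_def using f g by (intro L2_fun_measurable L2_fun_diff)
  have [measurable]: "wfun w \<tau> h \<in> borel_measurable M'" by (rule wfun_measurable[OF b hm])
  have "(\<integral>\<^sup>+x. ennreal ((cmod (h x))\<^sup>2) \<partial>M) = 0"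
  proof (subst nn_integral_0_iff_AE)
    show "AE x in M. ennreal ((cmod (h x))\<^sup>2) = 0" using eq by (auto simp: h_def)
  qed measurable
  with C[OF hm] have "(\<integral>\<^sup>+y. ennreal ((cmod (wfun w \<tau> h y))\<^sup>2) \<partial>M') = 0" by simp
  then have "AE y in M'. ennreal ((cmod (wfun w \<tau> h y))\<^sup>2) = 0"
    by (subst (asm) nn_integral_0_iff_AE) auto
  then show ?thesis
    by eventually_elim (auto simp: h_def wfun_def algebra_simps)
qed

lemma wcomp_class:
  assumes "wcomp_bounded M M' w \<tau>" "f \<in> L2_fun M"
  shows "wcomp M' w \<tau> (L2_class M f) = L2_class M' (wfun w \<tau> f)"
  unfolding wcomp_def using assms L2_rep_class[OF assms(2)]
  by (intro L2_class_eqI wfun_L2 wfun_AE_eq)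

lemma wcomp_in_carrier:
  "wcomp_bounded M M' w \<tau> \<Longrightarrow> F \<in> carrier (L2 M) \<Longrightarrow> wcomp M' w \<tau> F \<in> carrier (L2 M')"
  by (auto elim!: L2_carrierE simp: wcomp_class wfun_L2)

lemma linear_map_wcomp:
  assumes b: "wcomp_bounded M M' w \<tau>"
  shows "linear_map (L2 M) (L2 M') (wcomp M' w \<tau>)"
  unfolding linear_map_def using b
  by (auto elim!: L2_carrierE simp: wcomp_class wfun_L2 L2_add L2_smult L2_fun_add L2_fun_cmult wfun_add wfun_cmult)

lemma bounded_operator_wcomp:
  assumes b: "wcomp_bounded M M w \<tau>"
  shows "bounded_operator (L2 M) (wcomp M w \<tau>)"
  unfolding bounded_operator_def
proof (intro conjI linear_map_wcomp b)
  obtain C where C: "C \<ge> 0" "\<And>f. f \<in> borel_measurable M \<Longrightarrow> (\<integral>\<^sup>+y. ennreal ((cmod (wfun w \<tau> f y))\<^sup>2) \<partial>M)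
      \<le> ennreal C * (\<integral>\<^sup>+x. ennreal ((cmod (f x))\<^sup>2) \<partial>M)"
    using b by (elim wcomp_boundedE) blast
  show "\<exists>C. \<forall>x\<in>carrier (L2 M). hnorm (L2 M) (wcomp M w \<tau> x) \<le> C * hnorm (L2 M) x"
  proof (intro exI[of _ "sqrt C"] ballI)
    fix F assume "F \<in> carrier (L2 M)"
    then obtain f where f: "f \<in> L2_fun M" "F = L2_class M f" by (elim L2_carrierE)
    have "ennreal (\<integral>y. (cmod (wfun w \<tau> f y))\<^sup>2 \<partial>M) \<le> ennreal (C * (\<integral>x. (cmod (f x))\<^sup>2 \<partial>M))"
      using C(2)[OF L2_fun_measurable[OF f(1)]] f(1) b C(1)
      by (simp add: nn_integral_L2_fun wfun_L2 ennreal_mult)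
    then have "(\<integral>y. (cmod (wfun w \<tau> f y))\<^sup>2 \<partial>M) \<le> C * (\<integral>x. (cmod (f x))\<^sup>2 \<partial>M)"
      using C(1) by (subst (asm) ennreal_le_iff) auto
    then show "hnorm (L2 M) (wcomp M w \<tau> F) \<le> sqrt C * hnorm (L2 M) F"
      using f b by (simp add: wcomp_class L2_hnorm wfun_L2 flip: real_sqrt_mult)
  qed
qed

lemma wcomp_adjoint:
  assumes b: "wcomp_bounded M M' w \<tau>" "wcomp_bounded M' M w' \<tau>'"
    and int: "\<And>f g. f \<in> L2_fun M \<Longrightarrow> g \<in> L2_fun M' \<Longrightarrow>
      (\<integral>y. wfun w \<tau> f y * cnj (g y) \<partial>M') = (\<integral>x. f x * cnj (wfun w' \<tau>' g x) \<partial>M)"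
    and "F \<in> carrier (L2 M)" "G \<in> carrier (L2 M')"
  shows "cinner (L2 M') (wcomp M' w \<tau> F) G = cinner (L2 M) F (wcomp M w' \<tau>' G)"
  using assms(4,5) b int by (auto elim!: L2_carrierE simp: wcomp_class L2_cinner wfun_L2)

text \<open>Polarization reduces preservation of inner products to that of norms, which can be checked with
  nonnegative integrals alone.\<close>

lemma L2_polarization:
  assumes f: "f \<in> L2_fun M" and g: "g \<in> L2_fun M"
  defines "q c \<equiv> complex_of_real (\<integral>x. (cmod (f x + c * g x))\<^sup>2 \<partial>M)"
  shows "(\<integral>x. f x * cnj (g x) \<partial>M) = (q 1 - q (- 1) + \<i> * q \<i> - \<i> * q (- \<i>)) / 4"
proof -
  have int: "integrable M (\<lambda>x. complex_of_real ((cmod (f x + c * g x))\<^sup>2))" for c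
    using f g by (intro integrable_of_real L2_fun_integrable L2_fun_add L2_fun_cmult)
  have q: "q c = (\<integral>x. complex_of_real ((cmod (f x + c * g x))\<^sup>2) \<partial>M)" for c
    unfolding q_def by (rule integral_complex_of_real[symmetric])
  have sq: "complex_of_real ((cmod z)\<^sup>2) = z * cnj z" for z by (rule complex_norm_square)
  have "f x * cnj (g x) = (complex_of_real ((cmod (f x + 1 * g x))\<^sup>2) - complex_of_real ((cmod (f x + (- 1) * g x))\<^sup>2)
      + \<i> * complex_of_real ((cmod (f x + \<i> * g x))\<^sup>2) - \<i> * complex_of_real ((cmod (f x + (- \<i>) * g x))\<^sup>2)) / 4" for x
    by (simp only: sq) (simp add: algebra_simps)
  then have "(\<integral>x. f x * cnj (g x) \<partial>M) = (\<integral>x. (complex_of_real ((cmod (f x + 1 * g x))\<^sup>2) - complex_of_real ((cmod (f x + (- 1) * g x))\<^sup>2)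
      + \<i> * complex_of_real ((cmod (f x + \<i> * g x))\<^sup>2) - \<i> * complex_of_real ((cmod (f x + (- \<i>) * g x))\<^sup>2)) / 4 \<partial>M)"
    by presburger
  also have "\<dots> = (q 1 - q (- 1) + \<i> * q \<i> - \<i> * q (- \<i>)) / 4"
    unfolding q using int[of 1] int[of "- 1"] int[of \<i>] int[of "- \<i>"]
    by (simp only: Bochner_Integration.integral_divide_zero Bochner_Integration.integral_diff Bochner_Integration.integral_add
       Bochner_Integration.integral_mult_right_zero Bochner_Integration.integrable_diff Bochner_Integration.integrable_add integrable_mult_right)
  finally show ?thesis .
qed

lemma isometric_embedding_wcomp:
  assumes b: "wcomp_bounded M M' w \<tau>"
    and norm: "\<And>f. f \<in> L2_fun M \<Longrightarrow> (\<integral>y. (cmod (wfun w \<tau> f y))\<^sup>2 \<partial>M') = (\<integral>x. (cmod (f x))\<^sup>2 \<partial>M)"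
  shows "isometric_embedding (L2 M) (L2 M') (wcomp M' w \<tau>)"
  unfolding isometric_embedding_def
proof (intro conjI ballI linear_map_wcomp b)
  fix F G assume "F \<in> carrier (L2 M)" "G \<in> carrier (L2 M)"
  then obtain f g where fg: "f \<in> L2_fun M" "g \<in> L2_fun M" "F = L2_class M f" "G = L2_class M g"
    by (metis L2_carrierE)
  have "(\<integral>y. (cmod (wfun w \<tau> f y + c * wfun w \<tau> g y))\<^sup>2 \<partial>M') = (\<integral>x. (cmod (f x + c * g x))\<^sup>2 \<partial>M)" for c
    using norm[OF L2_fun_add[OF fg(1) L2_fun_cmult[OF fg(2)]], of c] by (simp only: wfun_add wfun_cmult)
  then have "(\<integral>y. wfun w \<tau> f y * cnj (wfun w \<tau> g y) \<partial>M') = (\<integral>x. f x * cnj (g x) \<partial>M)"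
    using fg b by (simp only: L2_polarization wfun_L2)
  then show "cinner (L2 M') (wcomp M' w \<tau> F) (wcomp M' w \<tau> G) = cinner (L2 M) F G"
    using fg b by (simp add: wcomp_class L2_cinner wfun_L2)
qed

section \<open>Transport along an injection of points\<close>

text \<open>The normal extension lives on functions of two real variables, while \<^const>\<open>subnormal\<close> requires a
  space of the same type as that of functions of one real variable. Carrying the measure along an
  injection of the plane into the line bridges the gap; any injection will do, since the sigma-algebra is
  carried along as well.\<close>

lemma borel_measurable_embed_iff:
  assumes "inj c"
  shows "f \<in> borel_measurable (embed_measure Q c) \<longleftrightarrow> (\<lambda>y. f (c y)) \<in> borel_measurable Q"
  using measurable_embed_measure1[of f c Q borel] measurable_compose[OF measurable_embed_measure2[OF assms]] by blast

lemma integral_embed_measure: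
  fixes f :: "'b \<Rightarrow> 'c :: {banach, second_countable_topology}"
  assumes "inj c" "(\<lambda>y. f (c y)) \<in> borel_measurable Q"
  shows "(\<integral>z. f z \<partial>embed_measure Q c) = (\<integral>y. f (c y) \<partial>Q)"
  using assms borel_measurable_embed_iff[OF assms(1), of f Q]
  by (subst embed_measure_eq_distr[OF assms(1)]) (auto intro!: integral_distr measurable_embed_measure2)

lemma nn_integral_embed_measure_comp:
  assumes "inj c" "(\<lambda>y. f (c y)) \<in> borel_measurable Q"
  shows "(\<integral>\<^sup>+z. f z \<partial>embed_measure Q c) = (\<integral>\<^sup>+y. f (c y) \<partial>Q)"
  using assms by (intro nn_integral_embed_measure measurable_embed_measure1)

lemma wcomp_bounded_embed_target:
  assumes d: "\<And>y. d (c y) = y" and b: "wcomp_bounded M Q w \<tau>"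
  shows "wcomp_bounded M (embed_measure Q c) (\<lambda>z. w (d z)) (\<lambda>z. \<tau> (d z))"
proof -
  obtain C where C: "C \<ge> 0"
    "\<And>f. f \<in> borel_measurable M \<Longrightarrow> wfun w \<tau> f \<in> borel_measurable Q"
    "\<And>f. f \<in> borel_measurable M \<Longrightarrow> (\<integral>\<^sup>+y. ennreal ((cmod (wfun w \<tau> f y))\<^sup>2) \<partial>Q)
      \<le> ennreal C * (\<integral>\<^sup>+x. ennreal ((cmod (f x))\<^sup>2) \<partial>M)"
    using b by (rule wcomp_boundedE) blast
  have eq: "wfun (\<lambda>z. w (d z)) (\<lambda>z. \<tau> (d z)) f (c y) = wfun w \<tau> f y" for f :: "'c \<Rightarrow> complex" and y
    by (simp add: wfun_def d)
  have c: "inj c" using d by (rule inj_on_inverseI)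
  show ?thesis
  proof (rule wcomp_boundedI[where C = C])
    fix f :: "'c \<Rightarrow> complex" assume f: "f \<in> borel_measurable M"
    then have [measurable]: "wfun w \<tau> f \<in> borel_measurable Q" by (rule C(2))
    then have "(\<lambda>y. wfun w \<tau> f y) \<in> borel_measurable Q" by simp
    then show "wfun (\<lambda>z. w (d z)) (\<lambda>z. \<tau> (d z)) f \<in> borel_measurable (embed_measure Q c)"
      by (simp only: borel_measurable_embed_iff[OF c] eq)
    show "(\<integral>\<^sup>+z. ennreal ((cmod (wfun (\<lambda>z. w (d z)) (\<lambda>z. \<tau> (d z)) f z))\<^sup>2) \<partial>embed_measure Q c)
      \<le> ennreal C * (\<integral>\<^sup>+x. ennreal ((cmod (f x))\<^sup>2) \<partial>M)"
      using C(3)[OF f] by (subst nn_integral_embed_measure_comp[OF c]) (simp_all add: eq)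
  qed
qed

lemma wcomp_bounded_embed_source:
  assumes c: "inj c" and b: "wcomp_bounded Q M' w \<tau>"
  shows "wcomp_bounded (embed_measure Q c) M' w (\<lambda>y. c (\<tau> y))"
proof -
  obtain C where C: "C \<ge> 0"
    "\<And>f. f \<in> borel_measurable Q \<Longrightarrow> wfun w \<tau> f \<in> borel_measurable M'"
    "\<And>f. f \<in> borel_measurable Q \<Longrightarrow> (\<integral>\<^sup>+y. ennreal ((cmod (wfun w \<tau> f y))\<^sup>2) \<partial>M')
      \<le> ennreal C * (\<integral>\<^sup>+x. ennreal ((cmod (f x))\<^sup>2) \<partial>Q)"
    using b by (rule wcomp_boundedE) blast
  have eq: "wfun w (\<lambda>y. c (\<tau> y)) f = wfun w \<tau> (\<lambda>x. f (c x))" for f :: "'b \<Rightarrow> complex"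
    by (simp add: wfun_def fun_eq_iff)
  show ?thesis
  proof (rule wcomp_boundedI[where C = C])
    fix f :: "'b \<Rightarrow> complex" assume "f \<in> borel_measurable (embed_measure Q c)"
    then have f [measurable]: "(\<lambda>x. f (c x)) \<in> borel_measurable Q"
      by (simp add: borel_measurable_embed_iff[OF c])
    show "wfun w (\<lambda>y. c (\<tau> y)) f \<in> borel_measurable M'"
      unfolding eq by (rule C(2)[OF f])
    show "(\<integral>\<^sup>+y. ennreal ((cmod (wfun w (\<lambda>y. c (\<tau> y)) f y))\<^sup>2) \<partial>M')
      \<le> ennreal C * (\<integral>\<^sup>+x. ennreal ((cmod (f x))\<^sup>2) \<partial>embed_measure Q c)"
      using C(3)[OF f] by (subst nn_integral_embed_measure_comp[OF c]) (simp_all add: eq)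
  qed
qed

lemma ex_inj_real_pair: "\<exists>c :: real \<times> real \<Rightarrow> real. inj c"
proof -
  have "infinite (UNIV :: real set)" by (simp add: infinite_UNIV_char_0)
  then obtain c :: "real \<times> real \<Rightarrow> real" where "bij_betw c (UNIV \<times> UNIV) UNIV"
    using card_of_ordIso[THEN iffD2, OF card_of_Times_same_infinite] by blast
  then show ?thesis by (auto simp: bij_betw_def)
qed

section \<open>Translation of the half line\<close>

lemma shift_measurable_lebesgue: "(\<lambda>x::real. x + s) \<in> lebesgue \<rightarrow>\<^sub>M lebesgue"
  using lebesgue_affine_measurable[where c = "\<lambda>x::real. 1" and t = s] by (simp add: add.commute)

lemma distr_lebesgue_shift: "distr lebesgue lebesgue (\<lambda>x::real. x + s) = lebesgue"
  using lebesgue_real_affine[of 1 s] by (simp add: density_1 add.commute)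

lemma half_line_extend:
  fixes f :: "real \<Rightarrow> 'a :: euclidean_space"
  shows "f \<in> borel_measurable half_line \<longleftrightarrow> (\<lambda>x. if 0 \<le> x then f x else 0) \<in> borel_measurable lebesgue"
  using borel_measurable_if[of "{0..}" f] by simp

lemma shift_measurable_half_line: "s \<ge> 0 \<Longrightarrow> (\<lambda>x. x + s) \<in> half_line \<rightarrow>\<^sub>M half_line"
  by (intro measurable_restrict_space3 shift_measurable_lebesgue) auto

lemma borel_measurable_half_line_shift_back:
  fixes f :: "real \<Rightarrow> 'a :: euclidean_space"
  assumes "f \<in> borel_measurable half_line"
  shows "(\<lambda>x. if s \<le> x then f (x - s) else 0) \<in> borel_measurable half_line"
proof -
  have "(\<lambda>x. if 0 \<le> x then f x else 0) \<in> borel_measurable lebesgue"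
    using assms half_line_extend by blast
  from measurable_compose[OF shift_measurable_lebesgue[of "- s"] this]
  have "(\<lambda>x. if s \<le> x then f (x - s) else 0) \<in> borel_measurable lebesgue"
    by (simp cong: if_cong)
  then show ?thesis by (rule measurable_restrict_space1)
qed

lemma nn_integral_half_line_shift:
  fixes F :: "real \<Rightarrow> real"
  assumes F: "F \<in> borel_measurable half_line" and s: "s \<ge> 0" and zero: "\<And>x. x < s \<Longrightarrow> F x = 0"
  shows "(\<integral>\<^sup>+x. ennreal (F x) \<partial>half_line) = (\<integral>\<^sup>+x. ennreal (F (x + s)) \<partial>half_line)"
proof -
  have G: "(\<lambda>x. ennreal (if 0 \<le> x then F x else 0)) \<in> borel_measurable lebesgue"
    using F half_line_extend by (intro measurable_compose[OF _ measurable_ennreal]) blast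
  have "(\<integral>\<^sup>+x. ennreal (F x) \<partial>half_line) = (\<integral>\<^sup>+x. ennreal (if 0 \<le> x then F x else 0) \<partial>distr lebesgue lebesgue (\<lambda>x. x + s))"
    by (simp only: distr_lebesgue_shift) (subst nn_integral_restrict_space, auto intro!: nn_integral_cong split: split_indicator)
  also have "\<dots> = (\<integral>\<^sup>+x. ennreal (if 0 \<le> x + s then F (x + s) else 0) \<partial>lebesgue)"
    using G by (intro nn_integral_distr shift_measurable_lebesgue) auto
  also have "\<dots> = (\<integral>\<^sup>+x. ennreal (F (x + s)) \<partial>half_line)"
    using s by (subst nn_integral_restrict_space) (auto intro!: nn_integral_cong split: split_indicator simp: zero)
  finally show ?thesis .
qed

lemma integral_half_line_shift:
  fixes F :: "real \<Rightarrow> 'a :: euclidean_space"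
  assumes F: "F \<in> borel_measurable half_line" and s: "s \<ge> 0" and zero: "\<And>x. x < s \<Longrightarrow> F x = 0"
  shows "(\<integral>x. F x \<partial>half_line) = (\<integral>x. F (x + s) \<partial>half_line)"
proof -
  have G: "(\<lambda>x. if 0 \<le> x then F x else 0) \<in> borel_measurable lebesgue"
    using F half_line_extend by blast
  have "(\<integral>x. F x \<partial>half_line) = (\<integral>x. (if 0 \<le> x then F x else 0) \<partial>distr lebesgue lebesgue (\<lambda>x. x + s))"
    by (simp only: distr_lebesgue_shift) (subst integral_restrict_space, auto intro!: Bochner_Integration.integral_cong split: split_indicator)
  also have "\<dots> = (\<integral>x. (if 0 \<le> x + s then F (x + s) else 0) \<partial>lebesgue)"
    using G by (intro integral_distr shift_measurable_lebesgue) auto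
  also have "\<dots> = (\<integral>x. F (x + s) \<partial>half_line)"
    using s by (subst integral_restrict_space) (auto intro!: Bochner_Integration.integral_cong split: split_indicator simp: zero)
  finally show ?thesis .
qed

text \<open>The composition \<open>f (x - s)\<close> alone need not be measurable on the half line, because \<open>f\<close> is arbitrary on
  negative arguments; the weight, vanishing for \<open>x < s\<close>, removes them.\<close>

lemma wfun_forward_measurable:
  assumes w: "w \<in> borel_measurable half_line" and zero: "\<And>x. x < s \<Longrightarrow> w x = 0"
    and f: "f \<in> borel_measurable half_line"
  shows "wfun w (\<lambda>x. x - s) f \<in> borel_measurable half_line"
proof -
  note [measurable] = w borel_measurable_half_line_shift_back[OF f, of s]
  have "(\<lambda>x. complex_of_real (w x) * (if s \<le> x then f (x - s) else 0)) \<in> borel_measurable half_line"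
    by measurable
  also have "(\<lambda>x. complex_of_real (w x) * (if s \<le> x then f (x - s) else 0)) = wfun w (\<lambda>x. x - s) f"
    using zero by (auto simp: wfun_def fun_eq_iff)
  finally show ?thesis .
qed

lemma wcomp_bounded_forward:
  assumes s: "s \<ge> 0" and w: "w \<in> borel_measurable half_line" and zero: "\<And>x. x < s \<Longrightarrow> w x = 0"
    and C: "AE x in half_line. \<bar>w (x + s)\<bar> \<le> C"
  shows "wcomp_bounded half_line half_line w (\<lambda>x. x - s)"
proof (rule wcomp_boundedI[where C = "C\<^sup>2"])
  fix f :: "real \<Rightarrow> complex" assume f: "f \<in> borel_measurable half_line"
  show m [measurable]: "wfun w (\<lambda>x. x - s) f \<in> borel_measurable half_line"
    using assms f by (intro wfun_forward_measurable)
  note [measurable] = f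
  have "(\<integral>\<^sup>+y. ennreal ((cmod (wfun w (\<lambda>x. x - s) f y))\<^sup>2) \<partial>half_line)
      = (\<integral>\<^sup>+y. ennreal ((cmod (wfun w (\<lambda>x. x - s) f (y + s)))\<^sup>2) \<partial>half_line)"
  proof (rule nn_integral_half_line_shift[OF _ s])
    show "(\<lambda>y. (cmod (wfun w (\<lambda>x. x - s) f y))\<^sup>2) \<in> borel_measurable half_line" by measurable
  qed (simp add: wfun_def zero)
  also have "\<dots> \<le> (\<integral>\<^sup>+y. ennreal (C\<^sup>2) * ennreal ((cmod (f y))\<^sup>2) \<partial>half_line)"
  proof (intro nn_integral_mono_AE, use C in eventually_elim)
    fix y assume "\<bar>w (y + s)\<bar> \<le> C"
    then have "(w (y + s))\<^sup>2 \<le> C\<^sup>2" by (metis abs_ge_zero power2_abs power_mono)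
    then have "(cmod (wfun w (\<lambda>x. x - s) f (y + s)))\<^sup>2 \<le> C\<^sup>2 * (cmod (f y))\<^sup>2"
      by (simp add: wfun_def norm_mult power_mult_distrib mult_right_mono)
    then show "ennreal ((cmod (wfun w (\<lambda>x. x - s) f (y + s)))\<^sup>2) \<le> ennreal (C\<^sup>2) * ennreal ((cmod (f y))\<^sup>2)"
      by (simp add: ennreal_leI flip: ennreal_mult)
  qed
  also have "\<dots> = ennreal (C\<^sup>2) * (\<integral>\<^sup>+y. ennreal ((cmod (f y))\<^sup>2) \<partial>half_line)"
    by (rule nn_integral_cmult) measurable
  finally show "(\<integral>\<^sup>+y. ennreal ((cmod (wfun w (\<lambda>x. x - s) f y))\<^sup>2) \<partial>half_line)
      \<le> ennreal (C\<^sup>2) * (\<integral>\<^sup>+y. ennreal ((cmod (f y))\<^sup>2) \<partial>half_line)" .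
qed

lemma wcomp_bounded_backward:
  assumes s: "s \<ge> 0" and w: "w \<in> borel_measurable half_line" and zero: "\<And>x. x < s \<Longrightarrow> w x = 0"
    and C: "AE x in half_line. \<bar>w x\<bar> \<le> C"
  shows "wcomp_bounded half_line half_line (\<lambda>x. w (x + s)) (\<lambda>x. x + s)"
proof (rule wcomp_boundedI[where C = "C\<^sup>2"])
  fix f :: "real \<Rightarrow> complex" assume f: "f \<in> borel_measurable half_line"
  note [measurable] = f w
  define F where "F x = complex_of_real (w x) * f x" for x
  have [measurable]: "F \<in> borel_measurable half_line" unfolding F_def by measurable
  have eq: "wfun (\<lambda>x. w (x + s)) (\<lambda>x. x + s) f = (\<lambda>x. F (x + s))"
    by (simp add: wfun_def F_def fun_eq_iff)
  show "wfun (\<lambda>x. w (x + s)) (\<lambda>x. x + s) f \<in> borel_measurable half_line"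
    unfolding eq using shift_measurable_half_line[OF s] by measurable
  have "(\<integral>\<^sup>+y. ennreal ((cmod (F (y + s)))\<^sup>2) \<partial>half_line) = (\<integral>\<^sup>+y. ennreal ((cmod (F y))\<^sup>2) \<partial>half_line)"
    by (intro nn_integral_half_line_shift[symmetric] s) (use zero in \<open>auto simp: F_def\<close>)
  also have "\<dots> \<le> (\<integral>\<^sup>+y. ennreal (C\<^sup>2) * ennreal ((cmod (f y))\<^sup>2) \<partial>half_line)"
  proof (intro nn_integral_mono_AE, use C in eventually_elim)
    fix y assume "\<bar>w y\<bar> \<le> C"
    then have "(w y)\<^sup>2 \<le> C\<^sup>2" by (metis abs_ge_zero power2_abs power_mono)
    then have "(cmod (F y))\<^sup>2 \<le> C\<^sup>2 * (cmod (f y))\<^sup>2"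
      by (simp add: F_def norm_mult power_mult_distrib mult_right_mono)
    then show "ennreal ((cmod (F y))\<^sup>2) \<le> ennreal (C\<^sup>2) * ennreal ((cmod (f y))\<^sup>2)"
      by (simp add: ennreal_leI flip: ennreal_mult)
  qed
  also have "\<dots> = ennreal (C\<^sup>2) * (\<integral>\<^sup>+y. ennreal ((cmod (f y))\<^sup>2) \<partial>half_line)"
    by (rule nn_integral_cmult) measurable
  finally show "(\<integral>\<^sup>+y. ennreal ((cmod (wfun (\<lambda>x. w (x + s)) (\<lambda>x. x + s) f y))\<^sup>2) \<partial>half_line)
      \<le> ennreal (C\<^sup>2) * (\<integral>\<^sup>+y. ennreal ((cmod (f y))\<^sup>2) \<partial>half_line)" unfolding eq .
qed

text \<open>Translation invariance of Lebesgue measure identifies the adjoint of a weighted forward shift as a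
  weighted backward shift; there is no boundary term because \<open>w\<close> vanishes below \<open>s\<close>.\<close>

lemma integral_forward_backward:
  assumes s: "s \<ge> 0" and w: "w \<in> borel_measurable half_line" and zero: "\<And>x. x < s \<Longrightarrow> w x = 0"
    and f: "f \<in> borel_measurable half_line" and g: "g \<in> borel_measurable half_line"
  shows "(\<integral>x. wfun w (\<lambda>x. x - s) f x * cnj (g x) \<partial>half_line)
    = (\<integral>x. f x * cnj (wfun (\<lambda>x. w (x + s)) (\<lambda>x. x + s) g x) \<partial>half_line)"
proof -
  note [measurable] = g wfun_forward_measurable[OF w zero f]
  have [measurable]: "cnj \<in> borel_measurable borel"
    by (intro borel_measurable_continuous_onI continuous_intros)
  have "(\<integral>x. wfun w (\<lambda>x. x - s) f x * cnj (g x) \<partial>half_line)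
      = (\<integral>x. wfun w (\<lambda>x. x - s) f (x + s) * cnj (g (x + s)) \<partial>half_line)"
  proof (rule integral_half_line_shift[OF _ s])
    show "(\<lambda>x. wfun w (\<lambda>x. x - s) f x * cnj (g x)) \<in> borel_measurable half_line" by measurable
  qed (simp add: wfun_def zero)
  also have "\<dots> = (\<integral>x. f x * cnj (wfun (\<lambda>x. w (x + s)) (\<lambda>x. x + s) g x) \<partial>half_line)"
    by (intro Bochner_Integration.integral_cong refl) (simp add: wfun_def mult_ac)
  finally show ?thesis .
qed

section \<open>Weighted translations\<close>

definition pos_continuous :: "(real \<Rightarrow> real) \<Rightarrow> bool" where
  "pos_continuous \<rho> \<longleftrightarrow> continuous_on {0..} \<rho> \<and> (\<forall>x\<ge>0. 0 < \<rho> x)"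

lemma pos_continuousD:
  assumes "pos_continuous \<rho>" shows "continuous_on {0..} \<rho>" "x \<ge> 0 \<Longrightarrow> \<rho> x > 0"
  using assms by (auto simp: pos_continuous_def)

lemma weighted_translation_eq_wcomp:
  "weighted_translation \<rho> t = wcomp half_line (weight \<rho> t) (\<lambda>x. x - t)"
  unfolding weighted_translation_def wcomp_def wfun_def
  by (intro ext arg_cong[of _ _ "L2_class half_line"]) (simp add: weight_def)

lemma weight_zero: "x < t \<Longrightarrow> weight \<rho> t x = 0"
  by (simp add: weight_def)

lemma weight_shift: "x \<ge> 0 \<Longrightarrow> weight \<rho> t (x + t) = sqrt (\<rho> (x + t) / \<rho> x)"
  by (simp add: weight_def)

lemma borel_measurable_weight:
  assumes "pos_continuous \<rho>" "t \<ge> 0"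
  shows "weight \<rho> t \<in> borel_measurable half_line"
proof -
  have c: "continuous_on {0..} (\<lambda>x. sqrt (\<rho> x / \<rho> (max 0 (x - t))))"
    using pos_continuousD[OF assms(1)]
    by (intro continuous_intros continuous_on_compose2[OF pos_continuousD(1)[OF assms(1)], where f = "\<lambda>x. max 0 (x - t)"])
       (auto simp: less_imp_neq[symmetric])
  have [measurable]: "(\<lambda>x. sqrt (\<rho> x / \<rho> (max 0 (x - t)))) \<in> borel_measurable half_line"
    by (rule continuous_imp_measurable_on_sets_lebesgue[OF c]) simp
  have setm: "{x \<in> space half_line. t \<le> x} \<in> sets half_line"
  proof -
    have eq: "{x \<in> space half_line. t \<le> x} = {0..} \<inter> {t..}" by (auto simp: space_restrict_space)
    show ?thesis unfolding eq by (subst sets_restrict_space_iff) auto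
  qed
  have "(\<lambda>x. if t \<le> x then sqrt (\<rho> x / \<rho> (max 0 (x - t))) else 0) \<in> borel_measurable half_line"
    by (rule measurable_If[OF _ _ setm]) measurable
  also have "(\<lambda>x. if t \<le> x then sqrt (\<rho> x / \<rho> (max 0 (x - t))) else 0) = weight \<rho> t"
    by (auto simp: weight_def fun_eq_iff max_def)
  finally show ?thesis .
qed

lemma borel_measurable_pos_continuous_shift:
  assumes "pos_continuous \<rho>" "s \<ge> 0"
  shows "(\<lambda>x. \<rho> (x + s)) \<in> borel_measurable half_line"
proof (rule continuous_imp_measurable_on_sets_lebesgue)
  show "continuous_on {0..} (\<lambda>x. \<rho> (x + s))"
    using assms(2)
    by (intro continuous_on_compose2[OF pos_continuousD(1)[OF assms(1)], where f = "\<lambda>x. x + s"] continuous_intros) auto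
qed simp

lemma AE_half_line_shift:
  assumes t: "t \<ge> 0" and P: "AE x in half_line. P x"
  shows "AE x in half_line. P (x + t)"
proof -
  have "AE x in lebesgue. x \<ge> 0 \<longrightarrow> P x"
    using P by (subst (asm) AE_restrict_space_iff) auto
  then have "AE x in distr lebesgue lebesgue (\<lambda>x. x + t). x \<ge> 0 \<longrightarrow> P x"
    by (simp only: distr_lebesgue_shift)
  then have "AE x in lebesgue. x + t \<ge> 0 \<longrightarrow> P (x + t)"
    by (rule AE_distrD[OF shift_measurable_lebesgue])
  then have "AE x in lebesgue. x \<ge> 0 \<longrightarrow> P (x + t)"
    by eventually_elim (use t in auto)
  then show ?thesis by (subst AE_restrict_space_iff) auto
qed

lemma AE_half_line_nonneg: "AE x in half_line. 0 \<le> x"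
  by (rule AE_I2) (simp add: space_restrict_space)

locale translation =
  fixes \<rho> :: "real \<Rightarrow> real" and t :: real
  assumes pc: "pos_continuous \<rho>" and t: "t \<ge> 0"
    and bd: "\<exists>C. AE x in half_line. \<bar>weight \<rho> t x\<bar> \<le> C"
begin

lemma bounded: "wcomp_bounded half_line half_line (weight \<rho> t) (\<lambda>x. x - t)"
proof -
  obtain C where "AE x in half_line. \<bar>weight \<rho> t x\<bar> \<le> C" using bd by blast
  from AE_half_line_shift[OF t this] show ?thesis
    by (intro wcomp_bounded_forward[OF t borel_measurable_weight[OF pc t]]) (simp_all add: weight_zero)
qed

lemma bounded_back: "wcomp_bounded half_line half_line (\<lambda>x. weight \<rho> t (x + t)) (\<lambda>x. x + t)"
proof -
  obtain C where "AE x in half_line. \<bar>weight \<rho> t x\<bar> \<le> C" using bd by blast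
  then show ?thesis
    by (intro wcomp_bounded_backward[OF t borel_measurable_weight[OF pc t]]) (simp_all add: weight_zero)
qed

definition T_adj :: "(real \<Rightarrow> complex) set \<Rightarrow> (real \<Rightarrow> complex) set" where
  "T_adj = wcomp half_line (\<lambda>x. weight \<rho> t (x + t)) (\<lambda>x. x + t)"

lemma T_adj_closed: "T_adj \<in> carrier (L2 half_line) \<rightarrow> carrier (L2 half_line)"
  unfolding T_adj_def using wcomp_in_carrier[OF bounded_back] by auto

lemma T_closed: "F \<in> carrier (L2 half_line) \<Longrightarrow> weighted_translation \<rho> t F \<in> carrier (L2 half_line)"
  unfolding weighted_translation_eq_wcomp by (rule wcomp_in_carrier[OF bounded])

lemma T_class: "f \<in> L2_fun half_line \<Longrightarrow> weighted_translation \<rho> t (L2_class half_line f)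
    = L2_class half_line (wfun (weight \<rho> t) (\<lambda>x. x - t) f)"
  unfolding weighted_translation_eq_wcomp by (rule wcomp_class[OF bounded])

lemma T_adjoint:
  assumes "F \<in> carrier (L2 half_line)" "G \<in> carrier (L2 half_line)"
  shows "cinner (L2 half_line) (weighted_translation \<rho> t F) G = cinner (L2 half_line) F (T_adj G)"
  unfolding weighted_translation_eq_wcomp T_adj_def
  using assms t borel_measurable_weight[OF pc t]
  by (intro wcomp_adjoint bounded bounded_back integral_forward_backward)
     (auto simp: weight_zero L2_fun_measurable)

lemma adj_T: "G \<in> carrier (L2 half_line) \<Longrightarrow> adj (L2 half_line) (weighted_translation \<rho> t) G = T_adj G"
  using T_adj_closed by (intro L2.adj_eqI T_adjoint) auto

lemma bounded_operator_T: "bounded_operator (L2 half_line) (weighted_translation \<rho> t)"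
  unfolding weighted_translation_eq_wcomp by (rule bounded_operator_wcomp[OF bounded])

lemma T_adj_T_class:
  assumes f: "f \<in> L2_fun half_line"
  shows "T_adj (weighted_translation \<rho> t (L2_class half_line f)) = L2_class half_line (\<lambda>x. complex_of_real (\<rho> (x + t) / \<rho> x) * f x)"
    and "(\<lambda>x. complex_of_real (\<rho> (x + t) / \<rho> x) * f x) \<in> L2_fun half_line"
proof -
  let ?h = "wfun (\<lambda>x. weight \<rho> t (x + t)) (\<lambda>x. x + t) (wfun (weight \<rho> t) (\<lambda>x. x - t) f)"
  let ?m = "\<lambda>x. complex_of_real (\<rho> (x + t) / \<rho> x) * f x"
  have h: "?h \<in> L2_fun half_line" using f by (intro wfun_L2[OF bounded_back] wfun_L2[OF bounded])
  have eq: "AE x in half_line. ?h x = ?m x"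
    using AE_half_line_nonneg
  proof eventually_elim
    fix x :: real assume x: "0 \<le> x"
    have "\<rho> (x + t) > 0" "\<rho> x > 0" using pos_continuousD(2)[OF pc] x t by auto
    then have "weight \<rho> t (x + t) * weight \<rho> t (x + t) = \<rho> (x + t) / \<rho> x" using x by (simp add: weight_shift)
    then show "?h x = ?m x" by (simp add: wfun_def flip: of_real_mult mult.assoc)
  qed
  have "(\<lambda>x. \<rho> (x + t) / \<rho> (x + 0)) \<in> borel_measurable half_line"
    by (intro borel_measurable_divide borel_measurable_pos_continuous_shift pc t order_refl)
  then have "(\<lambda>x. \<rho> (x + t) / \<rho> x) \<in> borel_measurable half_line" by simp
  then have "?m \<in> borel_measurable half_line"
    using L2_fun_measurable[OF f] by measurable
  with h show m: "?m \<in> L2_fun half_line" using eq by (rule L2_fun_AE_eq)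
  show "T_adj (weighted_translation \<rho> t (L2_class half_line f)) = L2_class half_line ?m"
    unfolding T_class[OF f] T_adj_def wcomp_class[OF bounded_back wfun_L2[OF bounded f]]
    using h m eq by (rule L2_class_eqI)
qed

end

text \<open>The cocycle identity that makes the weighted translations a semigroup.\<close>

lemma weight_mult:
  assumes "pos_continuous \<rho>" "s \<ge> 0" "t \<ge> 0"
  shows "weight \<rho> t x * weight \<rho> s (x - t) = weight \<rho> (s + t) x"
proof (cases "s + t \<le> x")
  case True
  then have "\<rho> x > 0" "\<rho> (x - t) > 0" "\<rho> (x - (s + t)) > 0"
    using assms(2,3) by (auto intro!: pos_continuousD(2)[OF assms(1)])
  then show ?thesis using True assms(2,3)
    by (simp add: weight_def algebra_simps flip: real_sqrt_mult)
qed (use assms in \<open>auto simp: weight_def\<close>)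

lemma (in translation) T_power_class:
  assumes f: "f \<in> L2_fun half_line"
  shows "(weighted_translation \<rho> t ^^ k) (L2_class half_line f)
      = L2_class half_line (wfun (weight \<rho> (real k * t)) (\<lambda>x. x - real k * t) f)
    \<and> wfun (weight \<rho> (real k * t)) (\<lambda>x. x - real k * t) f \<in> L2_fun half_line"
proof (induction k)
  case 0
  have eq: "AE x in half_line. f x = wfun (weight \<rho> 0) (\<lambda>x. x) f x"
    using AE_half_line_nonneg
  proof eventually_elim
    fix x :: real assume "0 \<le> x"
    then have "\<rho> x \<noteq> 0" using pos_continuousD(2)[OF pc] by fastforce
    then show "f x = wfun (weight \<rho> 0) (\<lambda>x. x) f x" using \<open>0 \<le> x\<close> by (simp add: wfun_def weight_def)
  qed
  have "wfun (weight \<rho> 0) (\<lambda>x. x - 0) f \<in> borel_measurable half_line"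
    using borel_measurable_weight[OF pc order_refl] L2_fun_measurable[OF f]
    by (intro wfun_forward_measurable) (auto simp: weight_zero)
  then have "wfun (weight \<rho> 0) (\<lambda>x. x) f \<in> L2_fun half_line"
    using L2_fun_AE_eq[OF f _ eq] by simp
  then show ?case using L2_class_eqI[OF f _ eq] by simp
next
  case (Suc k)
  let ?g = "wfun (weight \<rho> (real k * t)) (\<lambda>x. x - real k * t) f"
  have "wfun (weight \<rho> t) (\<lambda>x. x - t) ?g = wfun (weight \<rho> (real (Suc k) * t)) (\<lambda>x. x - real (Suc k) * t) f"
  proof
    fix x
    have "weight \<rho> t x * weight \<rho> (real k * t) (x - t) = weight \<rho> (real (Suc k) * t) x"
      using weight_mult[OF pc, of "real k * t" t x] t by (simp add: algebra_simps)
    then show "wfun (weight \<rho> t) (\<lambda>x. x - t) ?g x = wfun (weight \<rho> (real (Suc k) * t)) (\<lambda>x. x - real (Suc k) * t) f x"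
      by (simp add: wfun_def algebra_simps flip: of_real_mult)
  qed
  then show ?case
    using Suc T_class[of ?g] wfun_L2[OF bounded, of ?g] by simp
qed

text \<open>Hence \<open>T\<^sup>*\<^sup>kT\<^sup>k\<close> is multiplication by \<open>\<rho> (x + k t) / \<rho> x\<close>.\<close>

lemma (in translation) T_power_norm:
  assumes f: "f \<in> L2_fun half_line"
  shows "(hnorm (L2 half_line) ((weighted_translation \<rho> t ^^ k) (L2_class half_line f)))\<^sup>2
    = (\<integral>x. \<rho> (x + real k * t) / \<rho> x * (cmod (f x))\<^sup>2 \<partial>half_line)"
proof -
  let ?s = "real k * t" and ?g = "wfun (weight \<rho> (real k * t)) (\<lambda>x. x - real k * t) f"
  note k = T_power_class[OF f, of k]
  have [measurable]: "?g \<in> borel_measurable half_line" using k L2_fun_measurable by blast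
  have "(hnorm (L2 half_line) ((weighted_translation \<rho> t ^^ k) (L2_class half_line f)))\<^sup>2 = (\<integral>x. (cmod (?g x))\<^sup>2 \<partial>half_line)"
    using k by (simp add: L2_hnorm)
  also have "\<dots> = (\<integral>x. (cmod (?g (x + ?s)))\<^sup>2 \<partial>half_line)"
  proof (rule integral_half_line_shift)
    show "(\<lambda>x. (cmod (?g x))\<^sup>2) \<in> borel_measurable half_line" by measurable
  qed (use t in \<open>auto simp: wfun_def weight_zero\<close>)
  also have "\<dots> = (\<integral>x. \<rho> (x + ?s) / \<rho> x * (cmod (f x))\<^sup>2 \<partial>half_line)"
  proof (intro Bochner_Integration.integral_cong refl)
    fix x assume "x \<in> space half_line"
    then have x: "x \<ge> 0" by (simp add: space_restrict_space)
    then have "\<rho> (x + ?s) > 0" "\<rho> x > 0" using t pos_continuousD(2)[OF pc] by auto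
    then show "(cmod (?g (x + ?s)))\<^sup>2 = \<rho> (x + ?s) / \<rho> x * (cmod (f x))\<^sup>2"
      using x by (simp add: wfun_def weight_shift norm_mult power_mult_distrib)
  qed
  finally show ?thesis .
qed

section \<open>Complete hyperexpansivity in terms of the symbol\<close>

lemma half_line_integrable_interval:
  fixes g :: "real \<Rightarrow> real"
  assumes "continuous_on {0..} g" "0 \<le> a"
  shows "integrable half_line (\<lambda>x. indicator {a..b} x * g x)"
proof -
  have "continuous_on {a..b} g" using assms by (auto elim: continuous_on_subset)
  then have "integrable (lebesgue_on {a..b}) g" by (rule continuous_imp_integrable_real)
  then have "integrable lebesgue (\<lambda>x. indicator {a..b} x *\<^sub>R g x)" by (subst (asm) integrable_restrict_space) auto
  also have "(\<lambda>x. indicator {a..b} x *\<^sub>R g x) = (\<lambda>x. indicator {0..} x *\<^sub>R (indicator {a..b} x * g x))"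
    using assms(2) by (auto split: split_indicator)
  finally show ?thesis by (subst integrable_restrict_space) auto
qed

lemma nonpos_from_interval_integrals:
  fixes g :: "real \<Rightarrow> real"
  assumes cont: "continuous_on {0..} g"
    and int: "\<And>a b. 0 \<le> a \<Longrightarrow> a < b \<Longrightarrow> (\<integral>x. indicator {a..b} x * g x \<partial>half_line) \<le> 0"
    and x: "x \<ge> 0"
  shows "g x \<le> 0"
proof (rule ccontr)
  assume "\<not> g x \<le> 0"
  then have pos: "g x > 0" by simp
  obtain d where d: "d > 0" "\<And>y. y \<ge> 0 \<Longrightarrow> dist y x < d \<Longrightarrow> dist (g y) (g x) < g x / 2"
    using cont x pos unfolding continuous_on_iff by (metis atLeast_iff half_gt_zero)
  have low: "g x / 2 \<le> g y" if "y \<in> {x..x + d / 2}" for y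
  proof -
    have "\<bar>g y - g x\<bar> < g x / 2" using d(2)[of y] that d(1) x by (simp add: dist_real_def)
    then show ?thesis by linarith
  qed
  have "(\<integral>y. indicator {x..x + d / 2} y * (g x / 2) \<partial>half_line) \<le> (\<integral>y. indicator {x..x + d / 2} y * g y \<partial>half_line)"
  proof (rule integral_mono)
    show "integrable half_line (\<lambda>y. indicator {x..x + d / 2} y * (g x / 2))"
      using x by (intro half_line_integrable_interval continuous_on_const)
    show "integrable half_line (\<lambda>y. indicator {x..x + d / 2} y * g y)"
      using x cont by (intro half_line_integrable_interval)
    show "indicator {x..x + d / 2} y * (g x / 2) \<le> indicator {x..x + d / 2} y * g y" for y
      using low[of y] by (cases "y \<in> {x..x + d / 2}") simp_all
  qed
  also have "\<dots> \<le> 0" using d(1) x by (intro int) simp_all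
  finally have "(\<integral>y. indicator {x..x + d / 2} y * (g x / 2) \<partial>half_line) \<le> 0" .
  moreover have "(\<integral>y. indicator {x..x + d / 2} y * (g x / 2) \<partial>half_line) = d / 2 * (g x / 2)"
  proof -
    have "measure half_line {x..x + d / 2} = d / 2"
      using x d(1) by (subst measure_restrict_space) auto
    moreover have "{x..x + d / 2} \<inter> space half_line = {x..x + d / 2}" using x by (auto simp: space_restrict_space)
    ultimately show ?thesis
      by (simp only: integral_mult_left_zero Bochner_Integration.integral_indicator)
  qed
  moreover have "d / 2 * (g x / 2) > 0" using d(1) pos by simp
  ultimately show False by linarith
qed

text \<open>Testing the norm inequalities on \<open>\<surd>\<rho>\<close> restricted to an interval shows that the integral of the
  difference over that interval is nonpositive: the square of the test function cancels the denominator
  of \<open>\<rho> (x + k t) / \<rho> x\<close>.\<close>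

lemma (in translation) ndiff_nonpos:
  assumes che: "completely_hyperexpansive (L2 half_line) (weighted_translation \<rho> t)"
    and n: "1 \<le> n" and x: "0 \<le> x"
  shows "ndiff t n \<rho> x \<le> 0"
proof (rule nonpos_from_interval_integrals[OF _ _ x])
  have cs: "continuous_on {0..} (\<lambda>x. \<rho> (x + real k * t))" for k
    using t by (intro continuous_on_compose2[OF pos_continuousD(1)[OF pc], where f = "\<lambda>x. x + real k * t"] continuous_intros) auto
  show "continuous_on {0..} (\<lambda>x. ndiff t n \<rho> x)"
    unfolding ndiff_eq_sum by (intro continuous_on_sum continuous_on_mult continuous_on_const cs)
  fix a b :: real assume a: "0 \<le> a"
  define f where "f y = complex_of_real (indicator {a..b} y * sqrt (\<rho> y))" for y
  have sq: "(cmod (f y))\<^sup>2 = indicator {a..b} y * \<rho> y" if "y \<ge> 0" for y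
    using pos_continuousD(2)[OF pc that] by (simp add: f_def split: split_indicator)
  have "(\<lambda>y. indicator {a..b} y * sqrt (\<rho> y)) \<in> borel_measurable half_line"
    using pos_continuousD(1)[OF pc] a
    by (intro borel_measurable_integrable half_line_integrable_interval continuous_intros)
  then have "f \<in> borel_measurable half_line" unfolding f_def by measurable
  moreover have "integrable half_line (\<lambda>y. (cmod (f y))\<^sup>2)"
  proof -
    have "integrable half_line (\<lambda>y. indicator {a..b} y * \<rho> y)"
      by (intro half_line_integrable_interval pos_continuousD(1)[OF pc] a)
    also have "integrable half_line (\<lambda>y. indicator {a..b} y * \<rho> y) = integrable half_line (\<lambda>y. (cmod (f y))\<^sup>2)"
      by (intro Bochner_Integration.integrable_cong refl) (simp add: sq space_restrict_space)
    finally show ?thesis .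
  qed
  ultimately have f: "f \<in> L2_fun half_line" by (simp add: L2_fun_def)
  have norm: "(hnorm (L2 half_line) ((weighted_translation \<rho> t ^^ k) (L2_class half_line f)))\<^sup>2
      = (\<integral>y. indicator {a..b} y * \<rho> (y + real k * t) \<partial>half_line)" for k
    unfolding T_power_norm[OF f]
  proof (intro Bochner_Integration.integral_cong refl)
    fix y assume "y \<in> space half_line"
    then have "y \<ge> 0" by (simp add: space_restrict_space)
    then show "\<rho> (y + real k * t) / \<rho> y * (cmod (f y))\<^sup>2 = indicator {a..b} y * \<rho> (y + real k * t)"
      using pos_continuousD(2)[OF pc, of y] by (simp add: sq)
  qed
  have "(\<integral>y. indicator {a..b} y * ndiff t n \<rho> y \<partial>half_line)
      = (\<integral>y. (\<Sum>k\<le>n. (- 1) ^ k * real (n choose k) * (indicator {a..b} y * \<rho> (y + real k * t))) \<partial>half_line)"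
    unfolding ndiff_eq_sum sum_distrib_left by (intro Bochner_Integration.integral_cong sum.cong refl) (simp only: mult_ac)
  also have "\<dots> = (\<Sum>k\<le>n. (- 1) ^ k * real (n choose k) * (\<integral>y. indicator {a..b} y * \<rho> (y + real k * t) \<partial>half_line))"
    using half_line_integrable_interval[OF cs a]
    by (subst Bochner_Integration.integral_sum) (auto intro!: integrable_mult_right)
  also have "\<dots> = (\<Sum>k\<le>n. (- 1) ^ k * real (n choose k)
      * (hnorm (L2 half_line) ((weighted_translation \<rho> t ^^ k) (L2_class half_line f)))\<^sup>2)"
    by (simp only: norm)
  also have "\<dots> \<le> 0"
    using f n by (intro L2.completely_hyperexpansive_norms[OF che T_adj_closed T_adjoint]) auto
  finally show "(\<integral>y. indicator {a..b} y * ndiff t n \<rho> y \<partial>half_line) \<le> 0" .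
qed

section \<open>The Cauchy dual\<close>

lemma (in translation) dual_translation:
  assumes mono: "\<And>x. x \<ge> 0 \<Longrightarrow> \<rho> x \<le> \<rho> (x + t)"
  shows "translation (\<lambda>x. 1 / \<rho> x) t"
proof
  show "pos_continuous (\<lambda>x. 1 / \<rho> x)"
    using pc unfolding pos_continuous_def by (auto intro!: continuous_intros simp: less_imp_neq[symmetric])
  have "\<bar>weight (\<lambda>x. 1 / \<rho> x) t x\<bar> \<le> 1" for x
  proof (cases "t \<le> x")
    case True
    then show ?thesis
      using mono[of "x - t"] pos_continuousD(2)[OF pc, of x] pos_continuousD(2)[OF pc, of "x - t"] t
      by (simp add: weight_def)
  qed (simp add: weight_zero)
  then show "\<exists>C. AE x in half_line. \<bar>weight (\<lambda>x. 1 / \<rho> x) t x\<bar> \<le> C" by blast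
qed (rule t)

text \<open>\<open>T\<^sup>*T\<close> is multiplication by \<open>\<rho> (x + t) / \<rho> x\<close>, so its inverse is multiplication by the
  reciprocal, which is at most one because \<open>\<rho> x \<le> \<rho> (x + t)\<close>. Multiplying the weight
  \<open>\<surd>(\<rho> x / \<rho> (x - t))\<close> of \<open>T\<close> by it inverts that weight.\<close>

lemma (in translation) cauchy_dual_eq:
  assumes mono: "\<And>x. x \<ge> 0 \<Longrightarrow> \<rho> x \<le> \<rho> (x + t)" and F: "F \<in> carrier (L2 half_line)"
  shows "cauchy_dual (L2 half_line) (weighted_translation \<rho> t) F = weighted_translation (\<lambda>x. 1 / \<rho> x) t F"
proof -
  let ?H = "L2 half_line" and ?T = "weighted_translation \<rho> t"
  define m where "m x = complex_of_real (\<rho> (x + t) / \<rho> x)" for x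
  define w where "w x = complex_of_real (\<rho> x / \<rho> (x + t))" for x
  have mw: "m x * w x = 1" if "x \<ge> 0" for x
    using pos_continuousD(2)[OF pc, of x] pos_continuousD(2)[OF pc, of "x + t"] that t
    by (simp add: m_def w_def flip: of_real_mult)
  have TT: "(adj ?H ?T \<circ> ?T) (L2_class half_line f) = L2_class half_line (\<lambda>x. m x * f x)"
    "(\<lambda>x. m x * f x) \<in> L2_fun half_line" if "f \<in> L2_fun half_line" for f
    using T_adj_T_class[OF that] that by (auto simp: m_def adj_T T_closed)
  obtain f where f: "f \<in> L2_fun half_line" "F = L2_class half_line f" using F by (elim L2_carrierE)
  define g where "g x = w x * f x" for x
  have "(\<lambda>x. \<rho> (x + 0) / \<rho> (x + t)) \<in> borel_measurable half_line"
    by (intro borel_measurable_divide borel_measurable_pos_continuous_shift pc t order_refl)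
  then have "(\<lambda>x. \<rho> x / \<rho> (x + t)) \<in> borel_measurable half_line" by simp
  then have gm: "g \<in> borel_measurable half_line"
    using L2_fun_measurable[OF f(1)] unfolding g_def w_def by measurable
  have g: "g \<in> L2_fun half_line"
  proof -
    have "integrable half_line (\<lambda>x. (cmod (g x))\<^sup>2)"
    proof (rule Bochner_Integration.integrable_bound[OF L2_fun_integrable[OF f(1)]])
      show "AE x in half_line. norm ((cmod (g x))\<^sup>2) \<le> norm ((cmod (f x))\<^sup>2)"
        using AE_half_line_nonneg
      proof eventually_elim
        fix x :: real assume x: "0 \<le> x"
        have "cmod (w x) \<le> 1"
          using mono[OF x] pos_continuousD(2)[OF pc, of x] pos_continuousD(2)[OF pc, of "x + t"] x t
          by (simp add: w_def norm_divide)
        then have "cmod (g x) \<le> cmod (f x)"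
          using mult_right_mono[of "cmod (w x)" 1 "cmod (f x)"] by (simp add: g_def norm_mult)
        then have "(cmod (g x))\<^sup>2 \<le> (cmod (f x))\<^sup>2" by (rule power_mono) simp
        then show "norm ((cmod (g x))\<^sup>2) \<le> norm ((cmod (f x))\<^sup>2)" by simp
      qed
      show "(\<lambda>x. (cmod (g x))\<^sup>2) \<in> borel_measurable half_line" using gm by measurable
    qed
    then show ?thesis using gm by (simp add: L2_fun_def)
  qed
  have "inj_on (adj ?H ?T \<circ> ?T) (carrier ?H)"
  proof (rule inj_onI)
    fix F G assume FG: "F \<in> carrier ?H" "G \<in> carrier ?H" and eq: "(adj ?H ?T \<circ> ?T) F = (adj ?H ?T \<circ> ?T) G"
    obtain f g where fg: "f \<in> L2_fun half_line" "F = L2_class half_line f" "g \<in> L2_fun half_line" "G = L2_class half_line g"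
      using FG by (metis L2_carrierE)
    have "L2_class half_line (\<lambda>x. m x * f x) = L2_class half_line (\<lambda>x. m x * g x)"
      using eq unfolding fg(2,4) TT(1)[OF fg(1)] TT(1)[OF fg(3)] .
    then have "AE x in half_line. m x * f x = m x * g x"
      by (rule L2_class_eq_iff[OF TT(2)[OF fg(1)] TT(2)[OF fg(3)], THEN iffD1])
    with AE_half_line_nonneg have "AE x in half_line. f x = g x"
    proof eventually_elim
      fix x :: real assume "0 \<le> x" "m x * f x = m x * g x"
      then show "f x = g x" using mw[of x] by auto
    qed
    then show "F = G" using fg by (simp add: L2_class_eq_iff)
  qed
  moreover have "(adj ?H ?T \<circ> ?T) (L2_class half_line g) = F"
    unfolding TT(1)[OF g] f(2)
  proof (rule L2_class_eqI[OF TT(2)[OF g] f(1)])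
    show "AE x in half_line. m x * g x = f x"
      using AE_half_line_nonneg by eventually_elim (use mw in \<open>auto simp: g_def simp flip: mult.assoc\<close>)
  qed
  ultimately have "inv_into (carrier ?H) (adj ?H ?T \<circ> ?T) F = L2_class half_line g"
    using g by (intro inv_into_f_eq) auto
  then have "cauchy_dual ?H ?T F = L2_class half_line (wfun (weight \<rho> t) (\<lambda>x. x - t) g)"
    by (simp add: cauchy_dual_def T_class[OF g])
  also have "wfun (weight \<rho> t) (\<lambda>x. x - t) g = wfun (weight (\<lambda>x. 1 / \<rho> x) t) (\<lambda>x. x - t) f"
  proof
    fix x
    show "wfun (weight \<rho> t) (\<lambda>x. x - t) g x = wfun (weight (\<lambda>x. 1 / \<rho> x) t) (\<lambda>x. x - t) f x"
    proof (cases "t \<le> x")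
      case True
      then have pos: "\<rho> x > 0" "\<rho> (x - t) > 0" using pos_continuousD(2)[OF pc] t by auto
      have "sqrt (\<rho> x / \<rho> (x - t)) * sqrt (\<rho> (x - t) / \<rho> x) = 1"
        using pos by (simp flip: real_sqrt_mult)
      moreover have "sqrt (\<rho> (x - t) / \<rho> x) * sqrt (\<rho> (x - t) / \<rho> x) = \<rho> (x - t) / \<rho> x"
        using pos by simp
      ultimately have "sqrt (\<rho> x / \<rho> (x - t)) * (\<rho> (x - t) / \<rho> x) = sqrt (\<rho> (x - t) / \<rho> x)"
        by (metis mult.assoc mult_1)
      then have "weight \<rho> t x * (\<rho> (x - t) / \<rho> x) = weight (\<lambda>x. 1 / \<rho> x) t x"
        using True by (simp add: weight_def)
      then show ?thesis by (simp add: wfun_def g_def w_def flip: of_real_mult mult.assoc del: of_real_divide)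
    qed (simp add: wfun_def weight_zero)
  qed
  also have "L2_class half_line \<dots> = weighted_translation (\<lambda>x. 1 / \<rho> x) t F"
  proof -
    interpret dual: translation "\<lambda>x. 1 / \<rho> x" t by (rule dual_translation[OF mono])
    show ?thesis by (simp add: f dual.T_class)
  qed
  finally show ?thesis .
qed

section \<open>The normal extension\<close>

text \<open>The larger space is \<open>L\<^sup>2\<close> of the measure \<open>lebesgue \<Otimes> M\<close> on the plane. There the extension is translation
  in the first coordinate times a function of the second coordinate; translations preserve the measure
  and the factor is not affected by them, which is why the extension commutes with its adjoint.\<close>

definition slide :: "real \<Rightarrow> real \<times> real \<Rightarrow> real \<times> real" where
  "slide s y = (fst y + s, snd y)"

lemma distr_slide:
  assumes "real_distribution M"
  shows "slide s \<in> lebesgue \<Otimes>\<^sub>M M \<rightarrow>\<^sub>M lebesgue \<Otimes>\<^sub>M M"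
    and "distr (lebesgue \<Otimes>\<^sub>M M) (lebesgue \<Otimes>\<^sub>M M) (slide s) = lebesgue \<Otimes>\<^sub>M M"
proof -
  interpret M: real_distribution M by fact
  have eq: "slide s = (\<lambda>(x, y). (x + s, y))" by (auto simp: slide_def fun_eq_iff)
  show "slide s \<in> lebesgue \<Otimes>\<^sub>M M \<rightarrow>\<^sub>M lebesgue \<Otimes>\<^sub>M M"
    unfolding slide_def
    by (intro measurable_Pair measurable_compose[OF measurable_fst shift_measurable_lebesgue] measurable_snd)
  have id: "distr M M (\<lambda>x. x) = M" by (rule distr_id2) simp
  have "sigma_finite_measure (distr M M (\<lambda>x. x))" unfolding id by (rule M.sigma_finite_measure_axioms)
  from pair_measure_distr[OF shift_measurable_lebesgue[of s] measurable_ident_sets[OF refl, of M] this]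
  show "distr (lebesgue \<Otimes>\<^sub>M M) (lebesgue \<Otimes>\<^sub>M M) (slide s) = lebesgue \<Otimes>\<^sub>M M"
    unfolding eq id distr_lebesgue_shift by simp
qed

lemma borel_measurable_clamp01_powr:
  assumes "real_distribution M"
  shows "(\<lambda>y. clamp01 (snd y) powr a) \<in> borel_measurable (lebesgue \<Otimes>\<^sub>M M)"
proof -
  interpret M: real_distribution M by fact
  have "(\<lambda>u. clamp01 u powr a) \<in> borel_measurable M" by simp
  then show ?thesis by (rule measurable_compose[OF measurable_snd])
qed

lemma clamp01_powr_le_1: "a \<ge> 0 \<Longrightarrow> clamp01 u powr a \<le> 1"
  using clamp01[of u] by (simp add: powr_le1)

lemma wcomp_bounded_slide:
  assumes M: "real_distribution M" and a: "a \<ge> 0"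
  shows "wcomp_bounded (lebesgue \<Otimes>\<^sub>M M) (lebesgue \<Otimes>\<^sub>M M) (\<lambda>y. clamp01 (snd y) powr a) (slide s)"
proof (rule wcomp_boundedI[where C = 1])
  let ?Q = "lebesgue \<Otimes>\<^sub>M M"
  fix f :: "real \<times> real \<Rightarrow> complex" assume f: "f \<in> borel_measurable ?Q"
  note [measurable] = f borel_measurable_clamp01_powr[OF M, of a] distr_slide(1)[OF M, of s]
  show "wfun (\<lambda>y. clamp01 (snd y) powr a) (slide s) f \<in> borel_measurable ?Q"
    unfolding wfun_def by measurable
  have "(\<integral>\<^sup>+y. ennreal ((cmod (wfun (\<lambda>y. clamp01 (snd y) powr a) (slide s) f y))\<^sup>2) \<partial>?Q)
      \<le> (\<integral>\<^sup>+y. ennreal ((cmod (f (slide s y)))\<^sup>2) \<partial>?Q)"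
  proof (intro nn_integral_mono ennreal_leI power_mono)
    fix y
    have "clamp01 (snd y) powr a * cmod (f (slide s y)) \<le> 1 * cmod (f (slide s y))"
      using clamp01_powr_le_1[OF a] by (rule mult_right_mono) simp
    then show "cmod (wfun (\<lambda>y. clamp01 (snd y) powr a) (slide s) f y) \<le> cmod (f (slide s y))"
      by (simp add: wfun_def norm_mult)
  qed simp
  also have "\<dots> = (\<integral>\<^sup>+y. ennreal ((cmod (f y))\<^sup>2) \<partial>distr ?Q ?Q (slide s))"
    by (rule nn_integral_distr[symmetric]) measurable
  also have "\<dots> = ennreal 1 * (\<integral>\<^sup>+y. ennreal ((cmod (f y))\<^sup>2) \<partial>?Q)"
    unfolding distr_slide(2)[OF M] by simp
  finally show "(\<integral>\<^sup>+y. ennreal ((cmod (wfun (\<lambda>y. clamp01 (snd y) powr a) (slide s) f y))\<^sup>2) \<partial>?Q)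
      \<le> ennreal 1 * (\<integral>\<^sup>+y. ennreal ((cmod (f y))\<^sup>2) \<partial>?Q)" .
qed

text \<open>The factor that maps \<open>f\<close> on the half line to a function of \<open>(x, u)\<close>. Its square integrates to \<open>1\<close> over
  \<open>u\<close> by the moment formula, so the map is isometric. Passing from \<open>x - t\<close> to \<open>x\<close> multiplies it by
  \<open>u powr (t / 2)\<close> and divides it by the weight, so the map intertwines the two translations.\<close>

definition embed_weight :: "(real \<Rightarrow> real) \<Rightarrow> real \<times> real \<Rightarrow> real" where
  "embed_weight \<rho> y = (if 0 \<le> fst y then sqrt (clamp01 (snd y) powr fst y * \<rho> 0 / \<rho> (fst y)) else 0)"

lemma embed_weight_intertwines:
  assumes pc: "pos_continuous \<rho>" and t: "t \<ge> 0"
  shows "clamp01 u powr (t / 2) * embed_weight \<rho> (x - t, u) = embed_weight \<rho> (x, u) * weight \<rho> t x"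
proof (cases "t \<le> x")
  case True
  have pos: "\<rho> 0 > 0" "\<rho> x > 0" "\<rho> (x - t) > 0"
    using True t pos_continuousD(2)[OF pc] by auto
  have half: "clamp01 u powr (t / 2) = sqrt (clamp01 u powr t)"
    using powr_half_sqrt[of "clamp01 u powr t"] by (simp add: powr_powr)
  have add: "clamp01 u powr t * clamp01 u powr (x - t) = clamp01 u powr x"
    by (simp flip: powr_add)
  have E: "embed_weight \<rho> (x - t, u) = sqrt (clamp01 u powr (x - t) * \<rho> 0 / \<rho> (x - t))"
    using True by (simp add: embed_weight_def)
  have "clamp01 u powr (t / 2) * embed_weight \<rho> (x - t, u)
      = sqrt (clamp01 u powr t * (clamp01 u powr (x - t) * \<rho> 0 / \<rho> (x - t)))"
    unfolding E half by (rule real_sqrt_mult[symmetric])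
  also have "clamp01 u powr t * (clamp01 u powr (x - t) * \<rho> 0 / \<rho> (x - t)) = clamp01 u powr x * \<rho> 0 / \<rho> (x - t)"
    by (simp add: add[symmetric])
  also have "\<dots> = clamp01 u powr x * \<rho> 0 / \<rho> x * (\<rho> x / \<rho> (x - t))"
    using pos by simp
  also have "sqrt \<dots> = embed_weight \<rho> (x, u) * weight \<rho> t x"
  proof -
    have "embed_weight \<rho> (x, u) = sqrt (clamp01 u powr x * \<rho> 0 / \<rho> x)" "weight \<rho> t x = sqrt (\<rho> x / \<rho> (x - t))"
      using True t by (simp_all add: embed_weight_def weight_def)
    then show ?thesis by (simp only: real_sqrt_mult)
  qed
  finally show ?thesis .
qed (simp add: embed_weight_def weight_zero)

lemma embed_weight_isometry:
  assumes pc: "pos_continuous \<rho>" and M: "real_distribution M"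
    and mom: "\<And>x. x > 0 \<Longrightarrow> (\<integral>u. clamp01 u powr x \<partial>M) = \<rho> x / \<rho> 0"
    and f: "f \<in> borel_measurable half_line"
  shows "wfun (embed_weight \<rho>) fst f \<in> borel_measurable (lebesgue \<Otimes>\<^sub>M M)"
    and "(\<integral>\<^sup>+y. ennreal ((cmod (wfun (embed_weight \<rho>) fst f y))\<^sup>2) \<partial>(lebesgue \<Otimes>\<^sub>M M))
      = (\<integral>\<^sup>+x. ennreal ((cmod (f x))\<^sup>2) \<partial>half_line)"
proof -
  interpret M: real_distribution M by fact
  let ?Q = "lebesgue \<Otimes>\<^sub>M M"
  define f0 where "f0 x = (if 0 \<le> x then f x else 0)" for x
  define r0 where "r0 x = (if 0 \<le> x then \<rho> x else 0)" for x
  have f0: "f0 \<in> borel_measurable lebesgue" using f half_line_extend[of f] by (simp add: f0_def[abs_def])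
  have "\<rho> \<in> borel_measurable half_line"
    using borel_measurable_pos_continuous_shift[OF pc order_refl] by simp
  then have r0: "r0 \<in> borel_measurable lebesgue" using half_line_extend[of \<rho>] by (simp add: r0_def[abs_def])
  have [measurable]: "(\<lambda>y. f0 (fst y)) \<in> borel_measurable ?Q" "(\<lambda>y. r0 (fst y)) \<in> borel_measurable ?Q"
    using f0 r0 by (auto intro: measurable_compose[OF measurable_fst])
  have [measurable]: "(\<lambda>y. fst y) \<in> borel_measurable ?Q"
  proof -
    have "(\<lambda>x. x) \<in> borel_measurable lebesgue" by (rule measurable_completion) simp
    from measurable_compose[OF measurable_fst this] show ?thesis .
  qed
  have [measurable]: "(\<lambda>y. clamp01 (snd y)) \<in> borel_measurable ?Q"
  proof -
    have "clamp01 \<in> borel_measurable M" by simp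
    from measurable_compose[OF measurable_snd this] show ?thesis .
  qed
  have eq: "wfun (embed_weight \<rho>) fst f = (\<lambda>y. complex_of_real (sqrt (clamp01 (snd y) powr fst y * \<rho> 0 / r0 (fst y))) * f0 (fst y))"
    by (auto simp: wfun_def embed_weight_def f0_def r0_def fun_eq_iff)
  show m [measurable]: "wfun (embed_weight \<rho>) fst f \<in> borel_measurable ?Q"
    unfolding eq by measurable
  have "(\<integral>\<^sup>+y. ennreal ((cmod (wfun (embed_weight \<rho>) fst f y))\<^sup>2) \<partial>?Q)
      = (\<integral>\<^sup>+x. (\<integral>\<^sup>+u. ennreal ((cmod (wfun (embed_weight \<rho>) fst f (x, u)))\<^sup>2) \<partial>M) \<partial>lebesgue)"
    by (rule M.nn_integral_fst[symmetric]) measurable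
  also have "\<dots> = (\<integral>\<^sup>+x. ennreal ((cmod (f x))\<^sup>2) * indicator {0..} x \<partial>lebesgue)"
  proof (rule nn_integral_cong_AE)
    \<comment> \<open>The moment formula is not available at \<open>x = 0\<close>, where \<open>u powr x\<close> vanishes for \<open>u = 0\<close>.\<close>
    have "AE x in lborel. x \<noteq> (0::real)" by (rule AE_lborel_singleton)
    then have "AE x in lebesgue. x \<noteq> (0::real)" by (rule AE_completion)
    then show "AE x in lebesgue. (\<integral>\<^sup>+u. ennreal ((cmod (wfun (embed_weight \<rho>) fst f (x, u)))\<^sup>2) \<partial>M)
        = ennreal ((cmod (f x))\<^sup>2) * indicator {0..} x"
    proof eventually_elim
      fix x :: real assume "x \<noteq> 0"
      show "(\<integral>\<^sup>+u. ennreal ((cmod (wfun (embed_weight \<rho>) fst f (x, u)))\<^sup>2) \<partial>M)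
        = ennreal ((cmod (f x))\<^sup>2) * indicator {0..} x"
      proof (cases "x > 0")
        case True
        define K where "K = \<rho> 0 / \<rho> x * (cmod (f x))\<^sup>2"
        have pos: "\<rho> 0 > 0" "\<rho> x > 0" using True pos_continuousD(2)[OF pc] by auto
        have K: "K \<ge> 0" using pos by (simp add: K_def)
        have sq: "(cmod (wfun (embed_weight \<rho>) fst f (x, u)))\<^sup>2 = clamp01 u powr x * K" for u
          using True pos by (simp add: wfun_def embed_weight_def K_def norm_mult power_mult_distrib)
        have int: "integrable M (\<lambda>u. clamp01 u powr x)"
          by (rule M.integrable_const_bound[where B = 1]) (use True clamp01_powr_le_1 in auto)
        have "(\<integral>\<^sup>+u. ennreal (clamp01 u powr x * K) \<partial>M) = ennreal (\<integral>u. clamp01 u powr x * K \<partial>M)"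
          using int K by (intro nn_integral_eq_integral integrable_mult_left) auto
        also have "(\<integral>u. clamp01 u powr x * K \<partial>M) = \<rho> x / \<rho> 0 * K" using mom[OF True] by simp
        also have "\<rho> x / \<rho> 0 * K = (cmod (f x))\<^sup>2" using pos by (simp add: K_def)
        finally show ?thesis using True by (simp add: sq)
      qed (use \<open>x \<noteq> 0\<close> in \<open>auto simp: wfun_def embed_weight_def\<close>)
    qed
  qed
  also have "\<dots> = (\<integral>\<^sup>+x. ennreal ((cmod (f x))\<^sup>2) \<partial>half_line)"
    by (subst nn_integral_restrict_space) auto
  finally show "(\<integral>\<^sup>+y. ennreal ((cmod (wfun (embed_weight \<rho>) fst f y))\<^sup>2) \<partial>?Q)
      = (\<integral>\<^sup>+x. ennreal ((cmod (f x))\<^sup>2) \<partial>half_line)" .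
qed

text \<open>If \<open>\<rho>\<close> is a mixture of the functions \<open>u powr x\<close>, then the operator is a restriction of the
  corresponding mixture of the operators with symbols \<open>u powr x\<close>. Each of those is a constant multiple
  of a shift on the half line, which extends to the same multiple of a translation of the whole line;
  such an operator is normal.\<close>

theorem (in translation) subnormal_of_moments:
  assumes M: "real_distribution M"
    and mom: "\<And>x. x > 0 \<Longrightarrow> (\<integral>u. clamp01 u powr x \<partial>M) = \<rho> x / \<rho> 0"
  shows "subnormal (L2 half_line) (weighted_translation \<rho> t)"
proof -
  obtain c :: "real \<times> real \<Rightarrow> real" where c: "inj c" using ex_inj_real_pair by blast
  define d where "d = inv_into UNIV c"
  have d: "d (c y) = y" for y unfolding d_def using c by (rule inv_f_f)
  define Q where "Q = (lebesgue :: real measure) \<Otimes>\<^sub>M M"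
  define R where "R = embed_measure Q c"
  define p where "p y = clamp01 (snd y) powr (t / 2)" for y :: "real \<times> real"
  define N where "N s = wcomp R (\<lambda>z. p (d z)) (\<lambda>z. c (slide s (d z)))" for s
  define V where "V = wcomp R (\<lambda>z. embed_weight \<rho> (d z)) (\<lambda>z. fst (d z))"
  have Nb0: "wcomp_bounded Q Q p (slide s)" for s
    using wcomp_bounded_slide[OF M, of "t / 2" s] t unfolding Q_def p_def by simp
  have Nb: "wcomp_bounded R R (\<lambda>z. p (d z)) (\<lambda>z. c (slide s (d z)))" for s
    unfolding R_def by (rule wcomp_bounded_embed_source[OF c wcomp_bounded_embed_target[where c = c and d = d, OF d Nb0]])
  have iso: "wfun (embed_weight \<rho>) fst f \<in> borel_measurable Q"
    "(\<integral>\<^sup>+y. ennreal ((cmod (wfun (embed_weight \<rho>) fst f y))\<^sup>2) \<partial>Q) = (\<integral>\<^sup>+x. ennreal ((cmod (f x))\<^sup>2) \<partial>half_line)"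
    if "f \<in> borel_measurable half_line" for f
  proof -
    show "wfun (embed_weight \<rho>) fst f \<in> borel_measurable Q"
      unfolding Q_def using mom that by (rule embed_weight_isometry(1)[OF pc M])
    show "(\<integral>\<^sup>+y. ennreal ((cmod (wfun (embed_weight \<rho>) fst f y))\<^sup>2) \<partial>Q) = (\<integral>\<^sup>+x. ennreal ((cmod (f x))\<^sup>2) \<partial>half_line)"
      unfolding Q_def using mom that by (rule embed_weight_isometry(2)[OF pc M])
  qed
  have "wcomp_bounded half_line Q (embed_weight \<rho>) fst"
    by (rule wcomp_boundedI[where C = 1]) (simp_all add: iso)
  from wcomp_bounded_embed_target[where c = c and d = d, OF d this]
  have Vb: "wcomp_bounded half_line R (\<lambda>z. embed_weight \<rho> (d z)) (\<lambda>z. fst (d z))"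
    unfolding R_def .
  have V: "isometric_embedding (L2 half_line) (L2 R) V"
    unfolding V_def
  proof (rule isometric_embedding_wcomp[OF Vb])
    fix f assume f: "f \<in> L2_fun half_line"
    let ?g = "wfun (\<lambda>z. embed_weight \<rho> (d z)) (\<lambda>z. fst (d z)) f"
    have gc: "?g (c y) = wfun (embed_weight \<rho>) fst f y" for y by (simp add: wfun_def d)
    have [measurable]: "wfun (embed_weight \<rho>) fst f \<in> borel_measurable Q"
      by (rule iso(1)[OF L2_fun_measurable[OF f]])
    have "ennreal (\<integral>z. (cmod (?g z))\<^sup>2 \<partial>R) = (\<integral>\<^sup>+z. ennreal ((cmod (?g z))\<^sup>2) \<partial>R)"
      by (rule nn_integral_L2_fun[OF wfun_L2[OF Vb f], symmetric])
    also have "\<dots> = (\<integral>\<^sup>+y. ennreal ((cmod (?g (c y)))\<^sup>2) \<partial>Q)"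
      unfolding R_def by (rule nn_integral_embed_measure_comp[OF c]) (unfold gc, measurable)
    also have "\<dots> = ennreal (\<integral>x. (cmod (f x))\<^sup>2 \<partial>half_line)"
      unfolding gc iso(2)[OF L2_fun_measurable[OF f]] by (rule nn_integral_L2_fun[OF f])
    finally show "(\<integral>z. (cmod (?g z))\<^sup>2 \<partial>R) = (\<integral>x. (cmod (f x))\<^sup>2 \<partial>half_line)"
      by (subst (asm) ennreal_inj) auto
  qed
  have adj_int: "(\<integral>z. wfun (\<lambda>z. p (d z)) (\<lambda>z. c (slide (- t) (d z))) f z * cnj (g z) \<partial>R)
      = (\<integral>z. f z * cnj (wfun (\<lambda>z. p (d z)) (\<lambda>z. c (slide t (d z))) g z) \<partial>R)"
    if f: "f \<in> L2_fun R" and g: "g \<in> L2_fun R" for f g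
  proof -
    have fc [measurable]: "(\<lambda>y. f (c y)) \<in> borel_measurable Q" and gc [measurable]: "(\<lambda>y. g (c y)) \<in> borel_measurable Q"
      using f g L2_fun_measurable unfolding R_def borel_measurable_embed_iff[OF c, symmetric] by blast+
    have [measurable]: "slide s \<in> Q \<rightarrow>\<^sub>M Q" for s unfolding Q_def by (rule distr_slide(1)[OF M])
    have [measurable]: "p \<in> borel_measurable Q" unfolding Q_def p_def by (rule borel_measurable_clamp01_powr[OF M])
    have [measurable]: "(\<lambda>y. f (c (slide s y))) \<in> borel_measurable Q" "(\<lambda>y. g (c (slide s y))) \<in> borel_measurable Q" for s
      by (rule measurable_compose[OF _ fc] measurable_compose[OF _ gc], measurable)+
    have [measurable]: "cnj \<in> borel_measurable borel"
      by (intro borel_measurable_continuous_onI continuous_intros)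
    have "(\<integral>z. wfun (\<lambda>z. p (d z)) (\<lambda>z. c (slide (- t) (d z))) f z * cnj (g z) \<partial>R)
        = (\<integral>y. complex_of_real (p y) * f (c (slide (- t) y)) * cnj (g (c y)) \<partial>Q)"
      unfolding R_def wfun_def by (subst integral_embed_measure[OF c]) (simp_all add: d)
    also have "\<dots> = (\<integral>y. complex_of_real (p y) * f (c (slide (- t) y)) * cnj (g (c y)) \<partial>distr Q Q (slide t))"
      unfolding Q_def distr_slide(2)[OF M] ..
    also have "\<dots> = (\<integral>y. complex_of_real (p (slide t y)) * f (c (slide (- t) (slide t y))) * cnj (g (c (slide t y))) \<partial>Q)"
      by (rule integral_distr) measurable
    also have "\<dots> = (\<integral>y. f (c y) * cnj (complex_of_real (p y) * g (c (slide t y))) \<partial>Q)"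
      by (simp add: p_def slide_def mult_ac)
    also have "\<dots> = (\<integral>z. f z * cnj (wfun (\<lambda>z. p (d z)) (\<lambda>z. c (slide t (d z))) g z) \<partial>R)"
      unfolding R_def wfun_def by (subst integral_embed_measure[OF c]) (simp_all add: d)
    finally show ?thesis .
  qed
  have adjN: "adj (L2 R) (N (- t)) G = N t G" if "G \<in> carrier (L2 R)" for G
    unfolding N_def using that
    by (intro L2.adj_eqI wcomp_adjoint[OF Nb Nb adj_int] wcomp_in_carrier[OF Nb])
  have "normal_operator (L2 R) (N (- t))"
    unfolding normal_operator_def
  proof (intro conjI ballI)
    show "bounded_operator (L2 R) (N (- t))" unfolding N_def by (rule bounded_operator_wcomp[OF Nb])
    fix F assume F: "F \<in> carrier (L2 R)"
    then obtain f where f: "f \<in> L2_fun R" "F = L2_class R f" by (elim L2_carrierE)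
    have NN: "N s (N s' F) = L2_class R (wfun (\<lambda>z. p (d z)) (\<lambda>z. c (slide s (d z))) (wfun (\<lambda>z. p (d z)) (\<lambda>z. c (slide s' (d z))) f))" for s s'
      unfolding N_def f(2) wcomp_class[OF Nb f(1)] by (rule wcomp_class[OF Nb wfun_L2[OF Nb f(1)]])
    have "N (- t) (N t F) = N t (N (- t) F)"
      unfolding NN by (intro arg_cong[of _ _ "L2_class R"] ext) (simp add: wfun_def d p_def slide_def)
    moreover have "N (- t) F \<in> carrier (L2 R)" unfolding N_def by (rule wcomp_in_carrier[OF Nb F])
    ultimately show "N (- t) (adj (L2 R) (N (- t)) F) = adj (L2 R) (N (- t)) (N (- t) F)"
      using F by (simp add: adjN)
  qed
  moreover have "N (- t) (V F) = V (weighted_translation \<rho> t F)" if "F \<in> carrier (L2 half_line)" for F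
  proof -
    obtain f where f: "f \<in> L2_fun half_line" "F = L2_class half_line f" using \<open>F \<in> _\<close> by (elim L2_carrierE)
    have "wfun (\<lambda>z. p (d z)) (\<lambda>z. c (slide (- t) (d z))) (wfun (\<lambda>z. embed_weight \<rho> (d z)) (\<lambda>z. fst (d z)) f)
        = wfun (\<lambda>z. embed_weight \<rho> (d z)) (\<lambda>z. fst (d z)) (wfun (weight \<rho> t) (\<lambda>x. x - t) f)"
    proof
      fix z
      obtain x u where z: "d z = (x, u)" by (cases "d z")
      show "wfun (\<lambda>z. p (d z)) (\<lambda>z. c (slide (- t) (d z))) (wfun (\<lambda>z. embed_weight \<rho> (d z)) (\<lambda>z. fst (d z)) f) z
        = wfun (\<lambda>z. embed_weight \<rho> (d z)) (\<lambda>z. fst (d z)) (wfun (weight \<rho> t) (\<lambda>x. x - t) f) z"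
        using embed_weight_intertwines[OF pc t, of u x]
        by (simp add: wfun_def z d slide_def p_def flip: of_real_mult mult.assoc)
    qed
    then show ?thesis
      unfolding N_def V_def f(2) T_class[OF f(1)] wcomp_class[OF Vb f(1)]
        wcomp_class[OF Nb wfun_L2[OF Vb f(1)]] wcomp_class[OF Vb wfun_L2[OF bounded f(1)]] by simp
  qed
  ultimately show ?thesis
    unfolding subnormal_def using bounded_operator_T complex_hilbert_space_L2[of R] V by blast
qed

lemma (in translation) contraction_of_decreasing:
  assumes dec: "\<And>x. x \<ge> 0 \<Longrightarrow> \<rho> (x + t) \<le> \<rho> x"
  shows "contraction (L2 half_line) (weighted_translation \<rho> t)"
proof (rule L2.contractionI[OF bounded_operator_T T_adj_closed T_adjoint])
  fix F assume "F \<in> carrier (L2 half_line)"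
  then obtain f where f: "f \<in> L2_fun half_line" "F = L2_class half_line f" by (elim L2_carrierE)
  have le: "\<rho> (x + t) / \<rho> x * (cmod (f x))\<^sup>2 \<le> (cmod (f x))\<^sup>2" if "x \<ge> 0" for x
    using dec[OF that] pos_continuousD(2)[OF pc that] pos_continuousD(2)[OF pc, of "x + t"] that t
    by (intro mult_left_le_one_le) auto
  have "(hnorm (L2 half_line) (weighted_translation \<rho> t F))\<^sup>2 = (\<integral>x. \<rho> (x + t) / \<rho> x * (cmod (f x))\<^sup>2 \<partial>half_line)"
    using T_power_norm[OF f(1), of 1] f(2) by simp
  also have "\<dots> \<le> (\<integral>x. (cmod (f x))\<^sup>2 \<partial>half_line)"
    using L2_fun_integrable[OF f(1)] le by (intro integral_mono') (auto simp: space_restrict_space)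
  also have "\<dots> = (hnorm (L2 half_line) F)\<^sup>2" using f by (simp add: L2_hnorm)
  finally show "(hnorm (L2 half_line) (weighted_translation \<rho> t F))\<^sup>2 \<le> (hnorm (L2 half_line) F)\<^sup>2" .
qed

theorem proposition4p3:
  fixes \<phi> :: "real \<Rightarrow> real"
  assumes "symbol \<phi>"
    and "smooth_half_line \<phi>"
    and "\<forall>t\<ge>0. completely_hyperexpansive (L2 half_line) (weighted_translation \<phi> t)"
  shows "\<forall>t\<ge>0. subnormal (L2 half_line) (cauchy_dual (L2 half_line) (weighted_translation \<phi> t)) \<and>
    contraction (L2 half_line) (cauchy_dual (L2 half_line) (weighted_translation \<phi> t))"
proof -
  have pc: "pos_continuous \<phi>" using assms(1) by (simp add: symbol_def pos_continuous_def)
  have tr: "translation \<phi> t" if "t \<ge> 0" for t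
    using that pc assms(1) unfolding symbol_def by unfold_locales auto
  have alt: "ndiff h n \<phi> x \<le> 0" if "h \<ge> 0" "n \<ge> 1" "x \<ge> 0" for h n x
    using translation.ndiff_nonpos[OF tr[OF that(1)] _ that(2,3)] assms(3) that(1) by blast
  have mono: "\<phi> x \<le> \<phi> (x + t)" if "t \<ge> 0" "x \<ge> 0" for t x
    using alt[of t 1 x] that by simp
  define \<psi> where "\<psi> x = 1 / \<phi> x" for x
  have "\<exists>M. real_distribution M \<and> (\<forall>x>0. (\<integral>u. clamp01 u powr x \<partial>M) = \<psi> x / \<psi> 0)"
  proof (rule bernstein)
    show "continuous_on {0..} \<psi>"
      unfolding \<psi>_def using pos_continuousD[OF pc]
      by (intro continuous_intros) (auto simp: less_imp_neq[symmetric])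
    show "\<psi> 0 > 0" using pos_continuousD(2)[OF pc] by (simp add: \<psi>_def)
    show "ndiff h n \<psi> x \<ge> 0" if "h > 0" "x \<ge> 0" for h n x
      unfolding \<psi>_def using that by (intro ndiff_inverse_nonneg pos_continuousD(2)[OF pc] alt) auto
  qed
  then obtain M where M: "real_distribution M" "\<And>x. x > 0 \<Longrightarrow> (\<integral>u. clamp01 u powr x \<partial>M) = \<psi> x / \<psi> 0"
    by blast
  show ?thesis
  proof (intro allI impI)
    fix t :: real assume t: "t \<ge> 0"
    interpret translation \<phi> t by (rule tr[OF t])
    interpret dual: translation \<psi> t
      unfolding \<psi>_def by (rule dual_translation) (rule mono[OF t])
    have eq: "cauchy_dual (L2 half_line) (weighted_translation \<phi> t) F = weighted_translation \<psi> t F"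
      if "F \<in> carrier (L2 half_line)" for F
      unfolding \<psi>_def using that by (intro cauchy_dual_eq mono[OF t])
    have dec: "\<psi> (x + t) \<le> \<psi> x" if "x \<ge> 0" for x
      using mono[OF t that] pos_continuousD(2)[OF pc that] by (simp add: \<psi>_def frac_le)
    show "subnormal (L2 half_line) (cauchy_dual (L2 half_line) (weighted_translation \<phi> t)) \<and>
        contraction (L2 half_line) (cauchy_dual (L2 half_line) (weighted_translation \<phi> t))"
    proof
      show "subnormal (L2 half_line) (cauchy_dual (L2 half_line) (weighted_translation \<phi> t))"
        by (rule subnormal_cong[OF L2.complex_inner_space_axioms eq dual.subnormal_of_moments[OF M]])
      show "contraction (L2 half_line) (cauchy_dual (L2 half_line) (weighted_translation \<phi> t))"
        by (rule contraction_cong[OF L2.complex_inner_space_axioms eq dual.contraction_of_decreasing[OF dec]])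
    qed
  qed
qed

end
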